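(* Let $n\ge 2$, let $\varphi:\mathbb{D}^n\to\mathbb{D}$ be a holomorphic function and let $\sigma_\alpha=\sigma_\alpha[\varphi]$, $\alpha\in\mathbb{T}$, be its Clark measures on $\mathbb{T}^n$. Then \[ \int_{\mathbb{T}}\int_{\mathbb{T}^n} f\,d\sigma_\alpha\,dm_1(\alpha)=\int_{\mathbb{T}^n} f\,dm_n \] for all $f\in C(\mathbb{T}^n)$.
   Context: $\mathbb{D}$ is the open unit disc of $\mathbb{C}$ and $\mathbb{T}=\partial\mathbb{D}$. $m_n$ is the normalized Lebesgue measure on $\mathbb{T}^n$ ($m_1$ that on $\mathbb{T}$). The Poisson kernel of $\mathbb{D}^n$ is $P(z,\zeta)=\prod_{j=1}^n\frac{1-|z_j|^2}{|1-z_j\overline{\zeta_j}|^2}$, $z\in\mathbb{D}^n$, $\zeta\in\mathbb{T}^n$, and $P[\mu](z)=\int_{\mathbb{T}^n}P(z,\zeta)\,d\mu(\zeta)$ for a complex Borel measure $\mu$ on $\mathbb{T}^n$. For a holomorphic $\varphi:\mathbb{D}^n\to\mathbb{D}$ and $\alpha\in\mathbb{T}$, the Clark measure $\sigma_\alpha[\varphi]$ is the unique positive Borel measure on $\mathbb{T}^n$ such that \[ P[\sigma_\alpha[\varphi]](z)=\mathrm{Re}\left(\frac{\alpha+\varphi(z)}{\alpha-\varphi(z)}\right)=\frac{1-|\varphi(z)|^2}{|\alpha-\varphi(z)|^2},\qquad z\in\mathbb{D}^n. \] *)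

theory Defs
  imports "HOL-Probability.Probability"
begin

definition polydisc :: "(complex ^ 'n) set" where
  "polydisc = {z. \<forall>j. z $ j \<in> ball 0 1}"

definition torus :: "(complex ^ 'n) set" where
  "torus = {\<zeta>. \<forall>j. \<zeta> $ j \<in> sphere 0 1}"

text \<open>Holomorphy in several variables: real Frechet differentiability with a derivative that is
  linear over the complex numbers.\<close>

definition holomorphic_several_on :: "(complex ^ 'n \<Rightarrow> complex) \<Rightarrow> (complex ^ 'n) set \<Rightarrow> bool"
    (infixl "holomorphic'_several'_on" 50) where
  "f holomorphic_several_on U \<longleftrightarrow>
    (\<forall>z\<in>U. \<exists>f'. (f has_derivative f') (at z within U) \<and> (\<forall>c v. f' (c *s v) = c * f' v))"

definition circle_measure :: "complex measure" where
  "circle_measure =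
    distr (uniform_measure lborel {0..2 * pi}) (restrict_space borel (sphere 0 1)) cis"

text \<open>The product measure lives on functions from the index type; \<^term>\<open>vec_lambda\<close> carries it over
  to vectors.\<close>

definition torus_measure :: "(complex ^ 'n) measure" where
  "torus_measure =
    distr (\<Pi>\<^sub>M j\<in>UNIV. circle_measure) (restrict_space borel torus) vec_lambda"

definition poisson_kernel :: "complex ^ 'n \<Rightarrow> complex ^ 'n \<Rightarrow> real" where
  "poisson_kernel z \<zeta> =
    (\<Prod>j\<in>UNIV. (1 - (cmod (z $ j))\<^sup>2) / (cmod (1 - z $ j * cnj (\<zeta> $ j)))\<^sup>2)"

definition poisson_integral :: "(complex ^ 'n) measure \<Rightarrow> complex ^ 'n \<Rightarrow> real" where
  "poisson_integral \<mu> z = (\<integral>\<zeta>. poisson_kernel z \<zeta> \<partial>\<mu>)"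

definition is_clark_measure ::
    "(complex ^ 'n \<Rightarrow> complex) \<Rightarrow> complex \<Rightarrow> (complex ^ 'n) measure \<Rightarrow> bool" where
  "is_clark_measure \<phi> \<alpha> \<sigma> \<longleftrightarrow>
    sets \<sigma> = sets (restrict_space borel torus) \<and> finite_measure \<sigma> \<and>
    (\<forall>z\<in>polydisc. poisson_integral \<sigma> z = Re ((\<alpha> + \<phi> z) / (\<alpha> - \<phi> z)))"

definition clark_measure ::
    "(complex ^ 'n \<Rightarrow> complex) \<Rightarrow> complex \<Rightarrow> (complex ^ 'n) measure" where
  "clark_measure \<phi> \<alpha> = (THE \<sigma>. is_clark_measure \<phi> \<alpha> \<sigma>)"

end

theory Submission
  imports Defs "HOL-Complex_Analysis.Cauchy_Integral_Formula"
begin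

text \<open>
  Write \<open>u\<^sub>\<alpha> = (1 - \<bar>\<phi>\<bar>\<^sup>2) / \<bar>\<alpha> - \<phi>\<bar>\<^sup>2\<close>. If \<open>\<sigma>\<close> is a finite measure on the torus, then the symmetry of the
  Poisson kernel gives \<open>\<integral> f d\<sigma> = lim \<integral> f(\<eta>) P[\<sigma>](r\<eta>) dm\<^sub>n(\<eta>)\<close> as \<open>r\<close> tends to one. So \<open>\<sigma>\<close> is determined by
  its Poisson integral, and \<open>\<integral> f d\<sigma>\<^sub>\<alpha> = lim \<integral> f(\<eta>) u\<^sub>\<alpha>(r\<eta>) dm\<^sub>n(\<eta>)\<close>. For \<open>\<bar>w\<bar> < 1\<close> the function
  \<open>\<alpha> \<mapsto> (1 - \<bar>w\<bar>\<^sup>2) / \<bar>\<alpha> - w\<bar>\<^sup>2\<close> is itself a Poisson kernel and has mean one, so integrating in \<open>\<alpha>\<close> yields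
  the claim by dominated convergence and Fubini. The Clark measure exists as a weak limit of the
  measures \<open>u\<^sub>\<alpha>(r\<eta>) dm\<^sub>n(\<eta>)\<close>, all of mass \<open>u\<^sub>\<alpha>(0)\<close>; compactness is reduced to Helly's selection
  theorem on the line by a Borel encoding of the torus into the reals.
\<close>

section \<open>Weak compactness of probability measures on compact metric spaces\<close>

text \<open>Up to the factor 2/3 this is the usual parametrisation of the Cantor set. Base 3 is used
  because binary expansions are not unique, whereas here distinct sequences are separated by a
  gap.\<close>

definition ternary :: "(nat \<Rightarrow> bool) \<Rightarrow> real" where
  "ternary b = (\<Sum>i. of_bool (b i) * (1/3) ^ i)"

lemma summable_ternary: "summable (\<lambda>i. of_bool (b i) * (1/3) ^ i :: real)"
  by (rule summable_comparison_test'[where g = "\<lambda>i. (1/3)^i" and N = 0]) auto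

lemma ternary_bounds: "0 \<le> ternary b" "ternary b \<le> 3 / 2"
proof -
  show "0 \<le> ternary b"
    unfolding ternary_def by (intro suminf_nonneg summable_ternary) auto
  have "ternary b \<le> (\<Sum>i. (1/3) ^ i)"
    unfolding ternary_def by (intro suminf_le summable_ternary) auto
  also have "\<dots> = 3 / 2"
    by (subst suminf_geometric) auto
  finally show "ternary b \<le> 3 / 2" .
qed

text \<open>At the first index \<open>k\<close> where the sequences differ, the terms differ by
  \<open>(1/3)^k\<close>, while all later terms together contribute at most half of that. So the
  values differ by at least \<open>(1/3)^k / 2\<close>.\<close>

lemma ternary_separation:
  assumes close: "\<bar>ternary b - ternary c\<bar> < (1/3) ^ N / 2" and "i < N"
  shows "b i = c i"
proof (rule ccontr)
  assume "b i \<noteq> c i"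
  define k where "k = (LEAST k. b k \<noteq> c k)"
  have k: "b k \<noteq> c k" "k \<le> i"
    unfolding k_def using \<open>b i \<noteq> c i\<close> by (rule LeastI, rule Least_le)
  have below: "b j = c j" if "j < k" for j
    using not_less_Least[of j "\<lambda>k. b k \<noteq> c k"] that by (simp add: k_def)
  define d :: "nat \<Rightarrow> real" where "d j = of_bool (b j) * (1/3)^j - of_bool (c j) * (1/3)^j" for j
  have sd: "summable d"
    unfolding d_def by (intro summable_diff summable_ternary)
  have d_le: "norm (d j) \<le> (1/3)^j" for j
    by (auto simp: d_def)
  have "ternary b - ternary c = suminf d"
    unfolding ternary_def d_def by (intro suminf_diff summable_ternary)
  also have "\<dots> = (\<Sum>j. d (j + Suc k)) + (\<Sum>j<Suc k. d j)"
    by (rule suminf_split_initial_segment[OF sd])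
  also have "(\<Sum>j<Suc k. d j) = d k"
    using below by (simp add: d_def)
  finally have eq: "ternary b - ternary c = (\<Sum>j. d (j + Suc k)) + d k" .
  have "summable (\<lambda>j. (1/3::real)^(j + Suc k))"
    unfolding summable_iff_shift by (simp add: summable_geometric)
  then have "\<bar>\<Sum>j. d (j + Suc k)\<bar> \<le> (\<Sum>j. (1/3)^(j + Suc k))"
    using norm_suminf_le[of "\<lambda>j. d (j + Suc k)" "\<lambda>j. (1/3)^(j + Suc k)"] d_le
    by (simp only: real_norm_def)
  also have "\<dots> = (1/3)^k / 2"
  proof -
    have "(\<Sum>j. (1/3::real)^(j + Suc k)) = (\<Sum>j. (1/3)^j) * (1/3)^Suc k"
      unfolding power_add by (intro suminf_mult2[symmetric] summable_geometric) simp
    then show ?thesis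
      by (simp add: suminf_geometric)
  qed
  moreover have "\<bar>d k\<bar> = (1/3)^k"
    using k by (auto simp: d_def)
  ultimately have "(1/3)^k / 2 \<le> \<bar>ternary b - ternary c\<bar>"
    using eq by linarith
  moreover have "(1/3::real)^N \<le> (1/3)^k"
    using k \<open>i < N\<close> by (intro power_decreasing) auto
  ultimately show False
    using close by linarith
qed

section \<open>Borel encoding of a compact metric space\<close>

text \<open>Choose for every \<open>n\<close> a finite cover by balls of radius
  \<open>1 / Suc n\<close> and enumerate all these balls. Points that lie in the same balls of the
  \<open>n\<close>-th cover share one of them, so their distance is below twice the radius.\<close>

lemma compact_separating_open_sets:
  fixes X :: "'a::metric_space set"
  assumes "compact X" "X \<noteq> {}"
  obtains B :: "nat \<Rightarrow> 'a set" where "\<And>i. open (B i)"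
    "\<And>e. e > 0 \<Longrightarrow> \<exists>N. \<forall>x\<in>X. \<forall>y\<in>X. (\<forall>i<N. x \<in> B i \<longleftrightarrow> y \<in> B i) \<longrightarrow> dist x y < e"
proof -
  have "\<exists>F. finite F \<and> F \<subseteq> X \<and> X \<subseteq> (\<Union>c\<in>F. ball c (1 / Suc n))" for n
    using compactE_image[OF assms(1), of X "\<lambda>c. ball c (1 / Suc n)"] by fastforce
  then obtain F where F: "\<And>n. finite (F n)" "\<And>n. X \<subseteq> (\<Union>c\<in>F n. ball c (1 / Suc n))"
    by metis
  define G where "G n = (\<lambda>c. ball c (1 / Suc n)) ` F n" for n
  define C where "C = (\<Union>n. G n)"
  have finG: "finite (G n)" for n
    using F by (simp add: G_def)
  have "countable C"
    unfolding C_def using finG by (auto intro: countable_finite)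
  have "G 0 \<noteq> {}"
    using F(2)[of 0] \<open>X \<noteq> {}\<close> by (auto simp: G_def)
  then have "C \<noteq> {}"
    by (auto simp: C_def)
  show ?thesis
  proof (rule that[of "from_nat_into C"])
    have "from_nat_into C i \<in> C" for i
      using \<open>C \<noteq> {}\<close> by (rule from_nat_into)
    then show "open (from_nat_into C i)" for i
      by (auto simp: C_def G_def) (metis (mono_tags, lifting) UN_E image_iff open_ball)
  next
    fix e :: real assume "e > 0"
    then obtain n where n: "1 / Suc n < e / 2"
      using nat_approx_posE[of "e / 2"] by auto
    \<comment> \<open>The \<open>n\<close>-th cover is finite, so an initial segment of the
      enumeration exhausts it.\<close>
    define N where "N = Suc (Max (to_nat_on C ` G n))"
    show "\<exists>N. \<forall>x\<in>X. \<forall>y\<in>X.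
        (\<forall>i<N. x \<in> from_nat_into C i \<longleftrightarrow> y \<in> from_nat_into C i) \<longrightarrow> dist x y < e"
    proof (intro exI[of _ N] ballI impI)
      fix x y assume xy: "x \<in> X" "y \<in> X"
        "\<forall>i<N. x \<in> from_nat_into C i \<longleftrightarrow> y \<in> from_nat_into C i"
      obtain c where c: "c \<in> F n" "x \<in> ball c (1 / Suc n)"
        using F(2)[of n] xy by blast
      have g: "ball c (1 / Suc n) \<in> G n"
        using c by (auto simp: G_def)
      then have "ball c (1 / Suc n) \<in> C"
        by (auto simp: C_def)
      moreover have "to_nat_on C (ball c (1 / Suc n)) < N"
        using g finG by (auto simp: N_def less_Suc_eq_le)
      ultimately have "y \<in> ball c (1 / Suc n)"
        using xy(3) c(2) \<open>countable C\<close> by (metis from_nat_into_to_nat_on)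
      with c n show "dist x y < e"
        using dist_triangle3[of x y c] by (simp add: dist_commute)
    qed
  qed
qed

text \<open>An injective Borel map into the line with uniformly continuous inverse; it need not be
  continuous. It transfers Helly's selection theorem to compact metric spaces.\<close>

lemma compact_borel_encoding:
  fixes X :: "'a::metric_space set"
  assumes "compact X" "X \<noteq> {}"
  obtains s :: "'a \<Rightarrow> real" where "s \<in> borel_measurable borel" "\<And>x. 0 \<le> s x" "\<And>x. s x \<le> 3 / 2"
    "\<And>e. e > 0 \<Longrightarrow> \<exists>d>0. \<forall>x\<in>X. \<forall>y\<in>X. dist (s x) (s y) < d \<longrightarrow> dist x y < e"
proof -
  obtain B :: "nat \<Rightarrow> 'a set" where B: "\<And>i. open (B i)"
    "\<And>e. e > 0 \<Longrightarrow> \<exists>N. \<forall>x\<in>X. \<forall>y\<in>X. (\<forall>i<N. x \<in> B i \<longleftrightarrow> y \<in> B i) \<longrightarrow> dist x y < e"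
    using compact_separating_open_sets[OF assms] by metis
  define s where "s x = ternary (\<lambda>i. x \<in> B i)" for x
  show ?thesis
  proof (rule that[of s])
    have [measurable]: "B i \<in> sets borel" for i
      using B(1) by simp
    show "s \<in> borel_measurable borel"
      unfolding s_def ternary_def of_bool_def by measurable
    show "0 \<le> s x" "s x \<le> 3 / 2" for x
      unfolding s_def by (rule ternary_bounds)+
    fix e :: real assume "e > 0"
    then obtain N where N: "\<forall>x\<in>X. \<forall>y\<in>X. (\<forall>i<N. x \<in> B i \<longleftrightarrow> y \<in> B i) \<longrightarrow> dist x y < e"
      using B(2) by blast
    show "\<exists>d>0. \<forall>x\<in>X. \<forall>y\<in>X. dist (s x) (s y) < d \<longrightarrow> dist x y < e"
    \<comment> \<open>This is the gap of \<open>ternary_separation\<close>: closer codes agree in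
      the first \<open>N\<close> digits.\<close>
    proof (intro exI[of _ "(1/3)^N / 2"] conjI ballI impI)
      fix x y assume "x \<in> X" "y \<in> X" "dist (s x) (s y) < (1/3)^N / 2"
      then show "dist x y < e"
        using N ternary_separation[of "\<lambda>i. x \<in> B i" "\<lambda>i. y \<in> B i" N]
        unfolding s_def dist_real_def by blast
    qed simp
  qed
qed

section \<open>Weak sequential compactness\<close>

text \<open>The laws of \<open>s\<close> under \<open>M n\<close> live on a bounded interval, so
  they are tight and Helly's theorem yields a weak limit \<open>N\<close> of a subsequence. It is
  concentrated on the closure of the image of \<open>s\<close> and is carried back to
  \<open>X\<close> by the extended inverse of \<open>s\<close>.\<close>

theorem prob_measures_sequentially_compact:
  fixes X :: "'a::complete_space set" and M :: "nat \<Rightarrow> 'a measure"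
  assumes X: "compact X" "X \<noteq> {}"
    and M: "\<And>n. prob_space (M n)" "\<And>n. sets (M n) = sets (restrict_space borel X)"
  obtains r :: "nat \<Rightarrow> nat" and \<mu> where "strict_mono r" "prob_space \<mu>"
    "sets \<mu> = sets (restrict_space borel X)"
    "\<And>f :: 'a \<Rightarrow> real. continuous_on X f \<Longrightarrow> (\<lambda>n. \<integral>x. f x \<partial>M (r n)) \<longlonglongrightarrow> (\<integral>x. f x \<partial>\<mu>)"
proof -
  obtain s :: "'a \<Rightarrow> real" where s: "s \<in> borel_measurable borel" "\<And>x. 0 \<le> s x" "\<And>x. s x \<le> 3 / 2"
    "\<And>e. e > 0 \<Longrightarrow> \<exists>d>0. \<forall>x\<in>X. \<forall>y\<in>X. dist (s x) (s y) < d \<longrightarrow> dist x y < e"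
    using compact_borel_encoding[OF X] by metis
  have spM: "space (M n) = X" for n
    using sets_eq_imp_space_eq[OF M(2)] by (simp add: space_restrict_space)
  have sM [measurable]: "s \<in> borel_measurable (M n)" for n
    using measurable_restrict_space1[OF s(1)] by (simp cong: measurable_cong_sets add: M(2))
  \<comment> \<open>The image itself need not be closed, as \<open>s\<close> need not be continuous.
    The inverse of \<open>s\<close> is uniformly continuous and therefore extends to the
    closure.\<close>
  define K where "K = closure (s ` X)"
  have inj: "inj_on s X"
  proof (rule inj_onI, rule ccontr)
    fix x y assume "x \<in> X" "y \<in> X" "s x = s y" "x \<noteq> y"
    then show False
      using s(4)[of "dist x y"] by (metis dist_self less_irrefl zero_less_dist_iff)
  qed
  have "uniformly_continuous_on (s ` X) (inv_into X s)"
    unfolding uniformly_continuous_on_def using s(4) inj by (simp add: dist_commute)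
  then obtain g where g: "uniformly_continuous_on K g" "\<And>t. t \<in> s ` X \<Longrightarrow> inv_into X s t = g t"
    unfolding K_def using uniformly_continuous_on_extension_on_closure by metis
  have gs: "g (s x) = x" if "x \<in> X" for x
    using that g(2) inj by (metis imageI inv_into_f_f)
  have contg: "continuous_on K g"
    using g(1) by (rule uniformly_continuous_imp_continuous)
  have "closed X"
    using X(1) by (rule compact_imp_closed)
  have gK: "g ` K \<subseteq> X"
    unfolding K_def using contg[unfolded K_def] \<open>closed X\<close> gs
    by (intro image_closure_subset) auto
  have "closed K"
    by (simp add: K_def)
  then have [measurable]: "K \<in> sets borel" by simp
  have sK: "s x \<in> K" if "x \<in> X" for x
    unfolding K_def using that closure_subset[of "s ` X"] by auto
  obtain x0 where "x0 \<in> X" using X by auto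
  \<comment> \<open>The value \<open>x0\<close> off \<open>K\<close> is a default that makes
    \<open>h\<close> total; \<open>N\<close> gives no mass to the complement of
    \<open>K\<close>.\<close>
  define h where "h t = (if t \<in> K then g t else x0)" for t
  have hX: "h t \<in> X" for t
    using gK \<open>x0 \<in> X\<close> by (auto simp: h_def)
  have "h \<in> borel_measurable borel"
    unfolding h_def using contg
    by (intro borel_measurable_continuous_on_if) auto
  then have h_meas: "h \<in> borel \<rightarrow>\<^sub>M restrict_space borel X"
    using hX by (intro measurable_restrict_space2) auto
  define \<nu> where "\<nu> n = distr (M n) borel s" for n
  interpret M: prob_space "M n" for n by (rule M)
  interpret \<nu>: real_distribution "\<nu> n" for n
    unfolding \<nu>_def by (rule M.real_distribution_distr) (rule sM)
  have "tight \<nu>"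
    unfolding tight_def
  proof (intro conjI allI impI)
    show "real_distribution (\<nu> n)" for n ..
    fix e :: real assume "e > 0"
    \<comment> \<open>The interval is open on the left and \<open>s\<close> may take the value 0, so
      its left end is chosen negative.\<close>
    have "measure (\<nu> n) {-1<..2} = 1" for n
    proof -
      have "s -` {-1<..2} \<inter> space (M n) = space (M n)"
      proof (intro Int_absorb1 subsetI)
        show "x \<in> s -` {-1<..2}" for x
          using s(2)[of x] s(3)[of x] by simp
      qed
      then show ?thesis
        unfolding \<nu>_def by (subst measure_distr) (simp_all add: M.prob_space)
    qed
    with \<open>e > 0\<close> show "\<exists>a b. a < b \<and> (\<forall>n. measure (\<nu> n) {a<..b} > 1 - e)"
      by (intro exI[of _ "-1"] exI[of _ 2]) simp
  qed
  then obtain r N where r: "strict_mono r" and N: "real_distribution N" "weak_conv_m (\<nu> \<circ> r) N"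
    using tight_imp_convergent_subsubsequence[of \<nu> id] by (auto simp: strict_mono_id)
  interpret N: real_distribution N by (rule N)
  have conv: "(\<lambda>n. \<integral>t. F t \<partial>\<nu> (r n)) \<longlonglongrightarrow> (\<integral>t. F t \<partial>N)"
    if "continuous_on UNIV F" "\<And>t. norm (F t) \<le> B" for F :: "real \<Rightarrow> real" and B
    using weak_conv_imp_integral_bdd_continuous_conv[of "\<nu> \<circ> r" N F B] N(2) that
      \<nu>.real_distribution_axioms N.real_distribution_axioms
    by (simp add: continuous_on_eq_continuous_at)
  \<comment> \<open>The truncated distance to \<open>K\<close> is a bounded continuous function with
    integral zero under every \<nu> n, hence also under the weak limit.\<close>
  have AEK: "AE t in N. t \<in> K"
  proof -
    define F where "F t = min 1 (infdist t K)" for t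
    have cF: "continuous_on UNIV F"
      unfolding F_def by (intro continuous_intros)
    have bF: "norm (F t) \<le> 1" and F0: "0 \<le> F t" for t
      by (auto simp: F_def infdist_nonneg)
    have [measurable]: "F \<in> borel_measurable borel"
      using cF by (rule borel_measurable_continuous_onI)
    have "(\<integral>t. F t \<partial>\<nu> n) = 0" for n
    proof -
      have "(\<integral>t. F t \<partial>\<nu> n) = (\<integral>x. F (s x) \<partial>M n)"
        unfolding \<nu>_def by (subst integral_distr) simp_all
      also have "\<dots> = (\<integral>x. 0 \<partial>M n)"
        by (intro Bochner_Integration.integral_cong refl)
          (simp add: F_def sK spM)
      finally show ?thesis by simp
    qed
    then have "(\<integral>t. F t \<partial>N) = 0"
      using conv[OF cF bF] by (simp add: LIMSEQ_const_iff)
    moreover have "integrable N F"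
      by (rule N.integrable_const_bound[where B = 1]) (use bF in auto)
    ultimately have "AE t in N. F t = 0"
      using F0 by (simp add: integral_nonneg_eq_0_iff_AE)
    then show ?thesis
    proof eventually_elim
      case (elim t)
      then have "infdist t K = 0" by (auto simp: F_def min_def split: if_splits)
      moreover have "K \<noteq> {}" using X by (auto simp: K_def)
      ultimately show ?case
        using \<open>closed K\<close> in_closed_iff_infdist_zero by blast
    qed
  qed
  define \<mu> where "\<mu> = distr N (restrict_space borel X) h"
  have hN [measurable]: "h \<in> N \<rightarrow>\<^sub>M restrict_space borel X"
    using h_meas by (simp cong: measurable_cong_sets)
  show ?thesis
  proof (rule that[of r \<mu>])
    show "strict_mono r" by (rule r)
    show "prob_space \<mu>"
      unfolding \<mu>_def by (rule N.prob_space_distr) (rule hN)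
    show "sets \<mu> = sets (restrict_space borel X)"
      by (simp add: \<mu>_def)
    fix f :: "'a \<Rightarrow> real" assume f: "continuous_on X f"
    have [measurable]: "f \<in> borel_measurable (restrict_space borel X)"
      using f by (rule borel_measurable_continuous_on_restrict)
    obtain B where B: "\<And>x. x \<in> X \<Longrightarrow> norm (f x) \<le> B" "B \<ge> 0"
    proof -
      have "bounded (f ` X)"
        using X f by (intro compact_imp_bounded compact_continuous_image)
      then obtain B where "\<forall>y\<in>f ` X. norm y \<le> B" by (auto simp: bounded_iff)
      then show ?thesis
        using that[of "max B 0"] by force
    qed
    have "continuous_on K (f \<circ> g)"
      using contg f gK by (intro continuous_on_compose) (auto intro: continuous_on_subset)
    \<comment> \<open>Weak convergence on the line needs test functions on the whole line. Tietze's
      theorem extends \<open>f \<circ> g\<close> from \<open>K\<close> with the same bound.\<close>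
    then obtain F where F: "continuous_on UNIV F" "\<And>t. t \<in> K \<Longrightarrow> F t = (f \<circ> g) t"
      "\<And>t. norm (F t) \<le> B"
      using Tietze[of K "f \<circ> g" UNIV B] B gK \<open>closed K\<close> by (auto simp: image_subset_iff)
    have [measurable]: "F \<in> borel_measurable borel"
      using F(1) by (rule borel_measurable_continuous_onI)
    have "(\<integral>x. f x \<partial>M n) = (\<integral>t. F t \<partial>\<nu> n)" for n
    proof -
      have "(\<integral>t. F t \<partial>\<nu> n) = (\<integral>x. F (s x) \<partial>M n)"
        unfolding \<nu>_def by (subst integral_distr) simp_all
      also have "\<dots> = (\<integral>x. f x \<partial>M n)"
        by (intro Bochner_Integration.integral_cong refl) (simp add: F sK gs spM)
      finally show ?thesis by simp
    qed
    moreover have "(\<integral>x. f x \<partial>\<mu>) = (\<integral>t. F t \<partial>N)"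
    proof -
      have "(\<integral>x. f x \<partial>\<mu>) = (\<integral>t. f (h t) \<partial>N)"
        unfolding \<mu>_def by (subst integral_distr) simp_all
      also have "\<dots> = (\<integral>t. F t \<partial>N)"
      proof (rule integral_cong_AE)
        show "AE t in N. f (h t) = F t"
          using AEK by eventually_elim (simp add: F h_def)
      qed measurable
      finally show ?thesis .
    qed
    ultimately show "(\<lambda>n. \<integral>x. f x \<partial>M (r n)) \<longlonglongrightarrow> (\<integral>x. f x \<partial>\<mu>)"
      using conv[OF F(1,3)] by simp
  qed
qed

section \<open>The Poisson formula\<close>

text \<open>This is a coordinate factor of \<open>poisson_kernel\<close>. Taken at
  \<open>\<phi> z\<close> and a unimodular \<alpha>, it is also the function that the Clark measure
  has to represent, see \<open>Re_herglotz\<close>.\<close>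

definition poisson_disc :: "complex \<Rightarrow> complex \<Rightarrow> real" where
  "poisson_disc z \<zeta> = (1 - (cmod z)\<^sup>2) / (cmod (1 - z * cnj \<zeta>))\<^sup>2"

lemma poisson_kernel_eq_prod: "poisson_kernel z \<zeta> = (\<Prod>j\<in>UNIV. poisson_disc (z $ j) (\<zeta> $ j))"
  by (simp add: poisson_kernel_def poisson_disc_def)

lemma poisson_disc_nonneg: "cmod z \<le> 1 \<Longrightarrow> 0 \<le> poisson_disc z \<zeta>"
  unfolding poisson_disc_def by (auto intro!: divide_nonneg_nonneg simp: power_le_one)

text \<open>The denominator is at least \<open>(1 - cmod z)\<^sup>2\<close>. The bound is uniform in
  \<zeta> and serves to justify Fubini and dominated convergence.\<close>

lemma poisson_disc_le:
  assumes "cmod z < 1" "cmod \<zeta> \<le> 1"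
  shows "poisson_disc z \<zeta> \<le> 1 / (1 - cmod z)\<^sup>2"
proof -
  have "cmod (z * cnj \<zeta>) \<le> cmod z"
    using assms by (simp add: norm_mult mult_left_le)
  then have "1 - cmod z \<le> cmod (1 - z * cnj \<zeta>)"
    using norm_triangle_ineq2[of 1 "z * cnj \<zeta>"] by simp
  then have "(1 - cmod z)\<^sup>2 \<le> (cmod (1 - z * cnj \<zeta>))\<^sup>2"
    using assms by (intro power_mono) auto
  then show ?thesis
    unfolding poisson_disc_def using assms by (intro frac_le) auto
qed

lemma poisson_disc_measurable [measurable]:
  assumes [measurable]: "f \<in> borel_measurable M" "g \<in> borel_measurable M"
  shows "(\<lambda>x. poisson_disc (f x) (g x)) \<in> borel_measurable M"
proof -
  have [measurable]: "cnj \<in> borel_measurable borel"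
    by (intro borel_measurable_continuous_onI continuous_intros)
  show ?thesis unfolding poisson_disc_def by measurable
qed

lemma poisson_denominator_nonzero:
  assumes "cmod z < 1" "cmod \<zeta> \<le> 1" shows "1 - z * cnj \<zeta> \<noteq> 0"
proof
  assume "1 - z * cnj \<zeta> = 0"
  then have "cmod (z * cnj \<zeta>) = 1" by (metis norm_one right_minus_eq)
  moreover have "cmod (z * cnj \<zeta>) < 1"
    using assms mult_left_le[of "cmod \<zeta>" "cmod z"] by (simp add: norm_mult)
  ultimately show False by simp
qed

lemma continuous_on_poisson_disc [continuous_intros]:
  fixes f g :: "'a::topological_space \<Rightarrow> complex"
  assumes "continuous_on S f" "continuous_on S g"
    "\<And>x. x \<in> S \<Longrightarrow> cmod (f x) < 1" "\<And>x. x \<in> S \<Longrightarrow> cmod (g x) \<le> 1"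
  shows "continuous_on S (\<lambda>x. poisson_disc (f x) (g x))"
  unfolding poisson_disc_def using assms poisson_denominator_nonzero
  by (intro continuous_intros) auto

section \<open>Normalized Lebesgue measure on the circle and Poisson's formula in one
  variable\<close>

lemma sets_circle_measure [measurable_cong, simp]:
  "sets circle_measure = sets (restrict_space borel (sphere 0 1))"
  by (simp add: circle_measure_def)

lemma space_circle_measure [simp]: "space circle_measure = sphere 0 1"
  by (simp add: circle_measure_def space_restrict_space)

lemma cis_measurable_circle:
  "cis \<in> uniform_measure lborel {0..2 * pi} \<rightarrow>\<^sub>M restrict_space borel (sphere 0 1)"
proof -
  have "cis \<in> borel_measurable borel"
    by (intro borel_measurable_continuous_onI continuous_intros)
  then have "cis \<in> borel \<rightarrow>\<^sub>M restrict_space borel (sphere 0 1)"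
    by (intro measurable_restrict_space2) auto
  then show ?thesis
    by (simp cong: measurable_cong_sets)
qed

lemma prob_space_circle_measure: "prob_space circle_measure"
  unfolding circle_measure_def
  by (intro prob_space.prob_space_distr prob_space_uniform_measure cis_measurable_circle) auto

lemma measurable_circle_borel:
  "f \<in> M \<rightarrow>\<^sub>M circle_measure \<Longrightarrow> f \<in> borel_measurable M"
  by (simp add: measurable_restrict_space2_iff cong: measurable_cong_sets)

text \<open>The hypothesis is a gauge integral over the parameter interval because that is what a
  contour integral over the circle provides.\<close>

lemma integral_circle_measure:
  fixes g :: "complex \<Rightarrow> complex"
  assumes g: "continuous_on (sphere 0 1) g"
    and I: "((\<lambda>t. g (cis t)) has_integral I) {0..2 * pi}"
  shows "(\<integral>\<zeta>. g \<zeta> \<partial>circle_measure) = I / (2 * pi)"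
proof -
  have [measurable]: "g \<in> borel_measurable (restrict_space borel (sphere 0 1))"
    using g by (rule borel_measurable_continuous_on_restrict)
  have [measurable]: "cis \<in> borel \<rightarrow>\<^sub>M restrict_space borel (sphere 0 1)"
    using cis_measurable_circle by (simp cong: measurable_cong_sets)
  have um: "uniform_measure lborel {0..2 * pi} =
      density lborel (\<lambda>t. ennreal (indicator {0..2 * pi} t / (2 * pi)))"
    unfolding uniform_measure_def
    by (intro arg_cong[where f = "density lborel"] ext)
      (auto simp: indicator_def divide_ennreal[symmetric] simp flip: ennreal_1)
  have "(\<integral>\<zeta>. g \<zeta> \<partial>circle_measure) = (\<integral>t. g (cis t) \<partial>uniform_measure lborel {0..2 * pi})"
    unfolding circle_measure_def
    by (rule integral_distr[OF cis_measurable_circle]) measurable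
  also have "\<dots> = (\<integral>t. (indicator {0..2 * pi} t / (2 * pi)) *\<^sub>R g (cis t) \<partial>lborel)"
    unfolding um by (rule integral_density) (auto simp: indicator_def)
  also have "\<dots> = (\<integral>t. (indicator {0..2 * pi} t *\<^sub>R g (cis t)) / (2 * pi) \<partial>lborel)"
    by (intro Bochner_Integration.integral_cong) (auto simp: indicator_def scaleR_conv_of_real)
  also have "\<dots> = (LINT t:{0..2 * pi}|lborel. g (cis t)) / (2 * pi)"
    unfolding set_lebesgue_integral_def by simp
  also have "(LINT t:{0..2 * pi}|lborel. g (cis t)) = integral {0..2 * pi} (\<lambda>t. g (cis t))"
  proof (rule set_borel_integral_eq_integral)
    show "set_integrable lborel {0..2 * pi} (\<lambda>t. g (cis t))"
      using g by (intro borel_integrable_atLeastAtMost' continuous_on_compose2[OF g])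
        (auto intro!: continuous_intros)
  qed
  finally show ?thesis
    using I by (simp add: integral_unique)
qed

text \<open>On the circle, \<open>P(z,\<zeta>) = (1 - (cmod z)\<^sup>2) \<zeta> / ((1 - cnj z * \<zeta>) (\<zeta> - z))\<close>, so this is Cauchy's formula for
  \<open>(1 - (cmod z)\<^sup>2) g(u) / (1 - cnj z * u)\<close>.\<close>

lemma poisson_formula_disc:
  assumes g: "continuous_on (cball 0 1) g" "g holomorphic_on ball 0 1" and z: "cmod z < 1"
  shows "(\<integral>\<zeta>. of_real (poisson_disc z \<zeta>) * g \<zeta> \<partial>circle_measure) = g z"
proof -
  define G where "G u = g u * of_real (1 - (cmod z)\<^sup>2) / (1 - cnj z * u)" for u
  have nz: "1 - cnj z * u \<noteq> 0" if "cmod u \<le> 1" for u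
    using poisson_denominator_nonzero[of "cnj z" "cnj u"] that z by simp
  have "((\<lambda>u. G u / (u - z)) has_contour_integral 2 * of_real pi * \<i> * G z) (circlepath 0 1)"
  proof (rule Cauchy_integral_circlepath)
    show "continuous_on (cball 0 1) G"
      unfolding G_def using g nz by (intro continuous_intros) auto
    show "G holomorphic_on ball 0 1"
      unfolding G_def using g nz by (intro holomorphic_intros) auto
  qed (use z in auto)
  \<comment> \<open>At \<open>u = z\<close> the factor
    \<open>(1 - (cmod z)\<^sup>2) / (1 - cnj z * u)\<close> equals one.\<close>
  moreover have "G z = g z"
    using nz[of z] z complex_norm_square[of z] by (simp add: G_def mult.commute)
  ultimately have "((\<lambda>t. G (cis t) / (cis t - z) * \<i> * cis t) has_integral 2 * of_real pi * \<i> * g z) {0..2 * pi}"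
    using has_contour_integral_part_circlepath_iff[of 0 "2 * pi" "\<lambda>u. G u / (u - z)" _ 0 1]
    by (simp add: circlepath_def)
  \<comment> \<open>The derivative of the parametrisation contributes \<open>\<i> * cis t\<close>;
    its factor \<i> cancels the one in Cauchy's formula.\<close>
  from has_integral_divide[OF this, of \<i>]
  have *: "((\<lambda>t. G (cis t) / (cis t - z) * cis t) has_integral 2 * of_real pi * g z) {0..2 * pi}"
  proof -
    have "a * \<i> * b / \<i> = a * b" for a b :: complex
      by (subst nonzero_divide_eq_eq) (simp_all add: mult_ac)
    then show ?thesis
      using \<open>(_ has_integral _ / _) _\<close> by (simp only:)
  qed
  have eq: "of_real (poisson_disc z \<zeta>) * g \<zeta> = G \<zeta> / (\<zeta> - z) * \<zeta>" if "cmod \<zeta> = 1" for \<zeta>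
  proof -
    have "\<zeta> * cnj \<zeta> = 1" using that complex_norm_square[of \<zeta>] by simp
    then have "(1 - z * cnj \<zeta>) * \<zeta> = \<zeta> - z"
      by (simp add: algebra_simps)
    moreover have "1 - z * cnj \<zeta> \<noteq> 0"
      using poisson_denominator_nonzero z that by simp
    moreover have "of_real ((cmod (1 - z * cnj \<zeta>))\<^sup>2) = (1 - z * cnj \<zeta>) * (1 - cnj z * \<zeta>)"
      by (subst complex_norm_square) simp
    moreover have "\<zeta> \<noteq> 0" using that by auto
    ultimately show ?thesis
      using nz[of \<zeta>] that unfolding poisson_disc_def G_def of_real_divide
      by (simp flip: \<open>(1 - z * cnj \<zeta>) * \<zeta> = \<zeta> - z\<close> del: of_real_power add: mult.commute)
  qed
  have "(\<integral>\<zeta>. of_real (poisson_disc z \<zeta>) * g \<zeta> \<partial>circle_measure) = (2 * of_real pi * g z) / (2 * pi)"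
  proof (rule integral_circle_measure)
    show "continuous_on (sphere 0 1) (\<lambda>\<zeta>. of_real (poisson_disc z \<zeta>) * g \<zeta>)"
      using z by (intro continuous_intros continuous_on_subset[OF g(1)]) auto
    show "((\<lambda>t. of_real (poisson_disc z (cis t)) * g (cis t)) has_integral 2 * of_real pi * g z) {0..2 * pi}"
      using * by (simp add: eq)
  qed
  then show ?thesis by simp
qed

section \<open>Closed polydisc and torus: compactness and measurability\<close>

definition closed_polydisc :: "(complex ^ 'n) set" where
  "closed_polydisc = {z. \<forall>j. cmod (z $ j) \<le> 1}"

lemma polydisc_subset_closed: "polydisc \<subseteq> closed_polydisc"
  by (auto simp: polydisc_def closed_polydisc_def less_imp_le)

lemma torus_subset_closed: "torus \<subseteq> closed_polydisc"
  by (auto simp: torus_def closed_polydisc_def)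

lemma compact_closed_polydisc: "compact (closed_polydisc :: (complex ^ 'n) set)"
proof -
  have "closed (closed_polydisc :: (complex ^ 'n) set)"
    unfolding closed_polydisc_def
    by (intro closed_Collect_all closed_Collect_le continuous_intros)
  moreover have "norm z \<le> CARD('n)" if "z \<in> closed_polydisc" for z :: "complex ^ 'n"
  proof -
    have "norm z \<le> (\<Sum>j\<in>UNIV. norm (z $ j))"
      unfolding norm_vec_def by (rule L2_set_le_sum) simp
    also have "\<dots> \<le> (\<Sum>j\<in>(UNIV :: 'n set). 1)"
      using that by (intro sum_mono) (simp add: closed_polydisc_def)
    finally show ?thesis by simp
  qed
  ultimately show ?thesis
    by (auto simp: compact_eq_bounded_closed bounded_iff)
qed

lemma compact_torus: "compact (torus :: (complex ^ 'n) set)"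
proof -
  have "closed (torus :: (complex ^ 'n) set)"
    unfolding torus_def mem_sphere dist_norm
    by (intro closed_Collect_all closed_Collect_eq continuous_intros)
  then have "compact (torus \<inter> closed_polydisc :: (complex ^ 'n) set)"
    using compact_closed_polydisc by (rule closed_Int_compact)
  then show ?thesis
    by (simp only: Int_absorb2[OF torus_subset_closed])
qed

lemma vec_lambda_measurable:
  fixes f :: "'a \<Rightarrow> 'n::finite \<Rightarrow> complex"
  assumes [measurable]: "\<And>j. (\<lambda>x. f x j) \<in> borel_measurable M"
  shows "(\<lambda>x. \<chi> j. f x j) \<in> borel_measurable M"
proof (rule borel_measurable_euclidean_space[THEN iffD2, rule_format])
  fix i :: "complex ^ 'n" assume "i \<in> Basis"
  then obtain j b where i: "i = axis j b"
    by (auto simp: Basis_vec_def)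
  show "(\<lambda>x. (\<chi> j. f x j) \<bullet> i) \<in> borel_measurable M"
    unfolding i inner_axis by simp
qed

lemma vec_nth_measurable [measurable]:
  fixes f :: "'a \<Rightarrow> complex ^ 'n"
  assumes "f \<in> borel_measurable M"
  shows "(\<lambda>x. f x $ j) \<in> borel_measurable M"
  using assms by (rule borel_measurable_continuous_on[rotated]) (intro continuous_intros)

text \<open>The polydisc algebra, with holomorphy in the interior replaced by holomorphy in each variable,
  the remaining variables ranging over the closed disc; Poisson's formula can then be iterated.\<close>

definition polydisc_algebra :: "(complex ^ 'n \<Rightarrow> complex) \<Rightarrow> bool" where
  "polydisc_algebra F \<longleftrightarrow> continuous_on closed_polydisc F \<and>
    (\<forall>z\<in>closed_polydisc. \<forall>i. (\<lambda>w. F (\<chi> j. if j = i then w else z $ j)) holomorphic_on ball 0 1)"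

text \<open>Induction on the set \<open>J\<close> of coordinates integrated so far, the others being
  frozen at \<open>z\<close>. Fubini isolates a new coordinate, in which \<open>F\<close> is
  holomorphic while those in \<open>J\<close> stay on the circle, so the formula of the disc
  applies.\<close>

lemma poisson_formula_product:
  fixes F :: "complex ^ 'n \<Rightarrow> complex" and J :: "'n set"
  assumes F: "polydisc_algebra F" and z: "z \<in> polydisc" and "finite J"
  shows "(\<integral>x. of_real (\<Prod>j\<in>J. poisson_disc (z $ j) (x j)) * F (\<chi> j. if j \<in> J then x j else z $ j)
      \<partial>(\<Pi>\<^sub>M j\<in>J. circle_measure)) = F z"
  using \<open>finite J\<close>
proof (induction J rule: finite_induct)
  case empty
  show ?case
    by (simp add: PiM_empty lebesgue_integral_count_space_finite vec_lambda_eta)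
next
  case (insert i J)
  interpret C: prob_space circle_measure by (rule prob_space_circle_measure)
  interpret product_prob_space "\<lambda>_::'n. circle_measure" UNIV ..
  interpret PJ: prob_space "\<Pi>\<^sub>M j\<in>insert i J. circle_measure"
    by (intro prob_space_PiM prob_space_circle_measure)
  have cz: "cmod (z $ j) < 1" for j
    using z by (simp add: polydisc_def)
  have contF: "continuous_on closed_polydisc F"
    using F by (simp add: polydisc_algebra_def)
  have measF: "F \<in> borel_measurable (restrict_space borel closed_polydisc)"
    using contF by (rule borel_measurable_continuous_on_restrict)
  define V where "V x = (\<chi> j. if j \<in> insert i J then x j else z $ j)" for x :: "'n \<Rightarrow> complex"
  let ?f = "\<lambda>x. of_real (\<Prod>j\<in>insert i J. poisson_disc (z $ j) (x j)) * F (V x)"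
  have sp: "cmod (x j) = 1" if "x \<in> space (\<Pi>\<^sub>M j\<in>insert i J. circle_measure)" "j \<in> insert i J" for x j
    using that by (auto simp: space_PiM PiE_def Pi_def)
  have Vcl: "V x \<in> closed_polydisc" if "x \<in> space (\<Pi>\<^sub>M j\<in>insert i J. circle_measure)" for x
    using sp[OF that] cz by (simp add: V_def closed_polydisc_def less_imp_le)
  have comp: "(\<lambda>x. x j) \<in> borel_measurable (\<Pi>\<^sub>M j\<in>insert i J. circle_measure)" if "j \<in> insert i J" for j
    using that by (intro measurable_circle_borel measurable_component_singleton)
  have "V \<in> borel_measurable (\<Pi>\<^sub>M j\<in>insert i J. circle_measure)"
    unfolding V_def
  proof (rule vec_lambda_measurable)
    show "(\<lambda>x. if j \<in> insert i J then x j else z $ j) \<in> borel_measurable (\<Pi>\<^sub>M j\<in>insert i J. circle_measure)" for j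
      using comp[of j] by (cases "j \<in> insert i J") simp_all
  qed
  then have measV: "V \<in> (\<Pi>\<^sub>M j\<in>insert i J. circle_measure) \<rightarrow>\<^sub>M restrict_space borel closed_polydisc"
    using Vcl by (intro measurable_restrict_space2) auto
  have meas_prod: "(\<lambda>x. \<Prod>j\<in>insert i J. poisson_disc (z $ j) (x j)) \<in> borel_measurable (\<Pi>\<^sub>M j\<in>insert i J. circle_measure)"
    using comp by (intro borel_measurable_prod poisson_disc_measurable) auto
  obtain B where B: "\<And>v. v \<in> closed_polydisc \<Longrightarrow> cmod (F v) \<le> B"
    using compact_imp_bounded[OF compact_continuous_image[OF contF compact_closed_polydisc]]
    by (auto simp: bounded_iff)
  have int: "integrable (\<Pi>\<^sub>M j\<in>insert i J. circle_measure) ?f"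
  proof (rule PJ.integrable_const_bound[where B = "(\<Prod>j\<in>insert i J. 1 / (1 - cmod (z $ j))\<^sup>2) * B"])
    show "AE x in \<Pi>\<^sub>M j\<in>insert i J. circle_measure. norm (?f x) \<le> (\<Prod>j\<in>insert i J. 1 / (1 - cmod (z $ j))\<^sup>2) * B"
    proof (rule AE_I2)
      fix x assume x: "x \<in> space (\<Pi>\<^sub>M j\<in>insert i J. circle_measure)"
      have p: "0 \<le> poisson_disc (z $ j) (x j) \<and> poisson_disc (z $ j) (x j) \<le> 1 / (1 - cmod (z $ j))\<^sup>2"
        if "j \<in> insert i J" for j
        using cz[of j] sp[OF x that] by (simp add: poisson_disc_nonneg poisson_disc_le)
      have p0: "0 \<le> (\<Prod>j\<in>insert i J. poisson_disc (z $ j) (x j))"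
        using p by (intro prod_nonneg) blast
      have "norm (?f x) = (\<Prod>j\<in>insert i J. poisson_disc (z $ j) (x j)) * cmod (F (V x))"
        by (simp only: norm_mult norm_of_real abs_of_nonneg[OF p0])
      also have "\<dots> \<le> (\<Prod>j\<in>insert i J. 1 / (1 - cmod (z $ j))\<^sup>2) * B"
      proof (rule mult_mono)
        show "(\<Prod>j\<in>insert i J. poisson_disc (z $ j) (x j)) \<le> (\<Prod>j\<in>insert i J. 1 / (1 - cmod (z $ j))\<^sup>2)"
          using p by (intro prod_mono) blast
        show "cmod (F (V x)) \<le> B" by (rule B[OF Vcl[OF x]])
        show "0 \<le> (\<Prod>j\<in>insert i J. 1 / (1 - cmod (z $ j))\<^sup>2)"
          by (intro prod_nonneg) simp
      qed simp
      finally show "norm (?f x) \<le> (\<Prod>j\<in>insert i J. 1 / (1 - cmod (z $ j))\<^sup>2) * B" .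
    qed
    show "?f \<in> borel_measurable (\<Pi>\<^sub>M j\<in>insert i J. circle_measure)"
      by (intro borel_measurable_times measurable_compose[OF measV measF]
        measurable_compose[OF meas_prod]) simp
  qed
  have "integral\<^sup>L (\<Pi>\<^sub>M j\<in>insert i J. circle_measure) ?f =
      (\<integral>x. (\<integral>y. ?f (x(i := y)) \<partial>circle_measure) \<partial>(\<Pi>\<^sub>M j\<in>J. circle_measure))"
    using insert int by (intro product_integral_insert) auto
  also have "\<dots> = (\<integral>x. of_real (\<Prod>j\<in>J. poisson_disc (z $ j) (x j)) * F (\<chi> j. if j \<in> J then x j else z $ j)
      \<partial>(\<Pi>\<^sub>M j\<in>J. circle_measure))"
  proof (intro Bochner_Integration.integral_cong refl)
    fix x assume "x \<in> space (\<Pi>\<^sub>M j\<in>J. circle_measure)"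
    then have x: "cmod (x j) = 1" if "j \<in> J" for j
      using that by (auto simp: space_PiM PiE_def Pi_def)
    define W where "W = (\<chi> j. if j \<in> J then x j else z $ j)"
    have W: "W \<in> closed_polydisc"
      using x cz by (simp add: W_def closed_polydisc_def less_imp_le)
    define g where "g w = F (\<chi> j. if j = i then w else W $ j)" for w
    have "?f (x(i := y)) = of_real (\<Prod>j\<in>J. poisson_disc (z $ j) (x j)) * (of_real (poisson_disc (z $ i) y) * g y)" for y
    proof -
      have "(\<Prod>j\<in>J. poisson_disc (z $ j) ((x(i := y)) j)) = (\<Prod>j\<in>J. poisson_disc (z $ j) (x j))"
        using insert(2) by (intro prod.cong) auto
      moreover have "V (x(i := y)) = (\<chi> j. if j = i then y else W $ j)"
        by (auto simp: V_def W_def vec_eq_iff)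
      ultimately show ?thesis
        unfolding g_def prod.insert[OF insert(1,2)] by (simp only: fun_upd_same of_real_mult mult_ac)
    qed
    then have "(\<integral>y. ?f (x(i := y)) \<partial>circle_measure) =
        of_real (\<Prod>j\<in>J. poisson_disc (z $ j) (x j)) * (\<integral>y. of_real (poisson_disc (z $ i) y) * g y \<partial>circle_measure)"
      by simp
    also have "(\<integral>y. of_real (poisson_disc (z $ i) y) * g y \<partial>circle_measure) = g (z $ i)"
    proof (rule poisson_formula_disc)
      show "g holomorphic_on ball 0 1"
        unfolding g_def using F W by (simp add: polydisc_algebra_def)
      show "continuous_on (cball 0 1) g"
        unfolding g_def
      proof (rule continuous_on_compose2[OF contF])
        show "continuous_on (cball 0 1) (\<lambda>w. \<chi> j. if j = i then w else W $ j)"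
        proof (intro continuous_on_vec_lambda)
          show "continuous_on (cball 0 1) (\<lambda>w. if j = i then w else W $ j)" for j
            by (cases "j = i") auto
        qed
      qed (use W in \<open>auto simp: closed_polydisc_def\<close>)
    qed (rule cz)
    \<comment> \<open>Since \<open>i\<close> is not in \<open>J\<close>, the \<open>i\<close>-th
      coordinate of \<open>W\<close> is already \<open>z $ i\<close>.\<close>
    also have "g (z $ i) = F W"
      unfolding g_def using insert(2) by (intro arg_cong[where f = F]) (auto simp: vec_eq_iff W_def)
    finally show "(\<integral>y. ?f (x(i := y)) \<partial>circle_measure) =
        of_real (\<Prod>j\<in>J. poisson_disc (z $ j) (x j)) * F (\<chi> j. if j \<in> J then x j else z $ j)"
      unfolding W_def .
  qed
  also note insert.IH
  finally show ?case
    unfolding V_def .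
qed

section \<open>Product measure on the torus and Poisson's formula on the polydisc\<close>

lemma sets_torus_measure [measurable_cong, simp]:
  "sets torus_measure = sets (restrict_space borel torus)"
  by (simp add: torus_measure_def)

lemma space_torus_measure [simp]: "space torus_measure = torus"
  by (simp add: torus_measure_def space_restrict_space)

lemma vec_lambda_measurable_torus:
  "vec_lambda \<in> (\<Pi>\<^sub>M j\<in>(UNIV :: 'n::finite set). circle_measure) \<rightarrow>\<^sub>M restrict_space borel torus"
proof (rule measurable_restrict_space2)
  show "vec_lambda \<in> space (\<Pi>\<^sub>M j\<in>(UNIV :: 'n set). circle_measure) \<rightarrow> torus"
    by (auto simp: space_PiM torus_def)
  have "(\<lambda>x. \<chi> j. x j) \<in> borel_measurable (\<Pi>\<^sub>M j\<in>(UNIV :: 'n set). circle_measure)"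
    by (intro vec_lambda_measurable measurable_circle_borel measurable_component_singleton) simp
  then show "vec_lambda \<in> borel_measurable (\<Pi>\<^sub>M j\<in>(UNIV :: 'n set). circle_measure)"
    by simp
qed

lemma prob_space_torus_measure: "prob_space torus_measure"
  unfolding torus_measure_def
  by (intro prob_space.prob_space_distr prob_space_PiM prob_space_circle_measure vec_lambda_measurable_torus)

lemma poisson_kernel_measurable [measurable]:
  fixes f g :: "'a \<Rightarrow> complex ^ 'n"
  assumes [measurable]: "f \<in> borel_measurable M" "g \<in> borel_measurable M"
  shows "(\<lambda>x. poisson_kernel (f x) (g x)) \<in> borel_measurable M"
  unfolding poisson_kernel_eq_prod by measurable

lemma id_borel_restrict: "(\<lambda>x. x) \<in> borel_measurable (restrict_space borel S)"
  by (rule measurable_restrict_space1) simp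

theorem poisson_formula_polydisc:
  fixes F :: "complex ^ 'n \<Rightarrow> complex"
  assumes F: "polydisc_algebra F" and z: "z \<in> polydisc"
  shows "(\<integral>\<zeta>. of_real (poisson_kernel z \<zeta>) * F \<zeta> \<partial>torus_measure) = F z"
proof -
  have "continuous_on torus F"
    using F torus_subset_closed by (auto simp: polydisc_algebra_def intro: continuous_on_subset)
  then have [measurable]: "F \<in> borel_measurable (restrict_space borel torus)"
    by (rule borel_measurable_continuous_on_restrict)
  note [measurable] = id_borel_restrict
  have "(\<integral>\<zeta>. of_real (poisson_kernel z \<zeta>) * F \<zeta> \<partial>torus_measure) =
      (\<integral>x. of_real (poisson_kernel z (vec_lambda x)) * F (vec_lambda x) \<partial>(\<Pi>\<^sub>M j\<in>UNIV. circle_measure))"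
    unfolding torus_measure_def
    by (rule integral_distr[OF vec_lambda_measurable_torus]) measurable
  also have "\<dots> = F z"
    using poisson_formula_product[OF F z finite, of UNIV] by (simp add: poisson_kernel_eq_prod)
  finally show ?thesis .
qed

section \<open>Members of the polydisc algebra\<close>

lemma closed_polydisc_update:
  "\<lbrakk>z \<in> closed_polydisc; cmod w \<le> 1\<rbrakk> \<Longrightarrow> (\<chi> j. if j = i then w else z $ j) \<in> closed_polydisc"
  by (auto simp: closed_polydisc_def)

lemma scaleR_closed_polydisc:
  assumes "z \<in> closed_polydisc" "0 \<le> r" "r < 1"
  shows "r *\<^sub>R z \<in> polydisc"
proof -
  have "r * cmod (z $ j) < 1" for j
  proof -
    have "r * cmod (z $ j) \<le> r"
      using assms by (simp add: closed_polydisc_def mult_left_le)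
    with assms show ?thesis by simp
  qed
  with assms show ?thesis by (simp add: polydisc_def)
qed

text \<open>For fixed \<zeta> on the torus, the squared distance to \<zeta> agrees on the torus with
  the real part of such a function; this gives the second moment of the Poisson kernel.\<close>

lemma polydisc_algebra_linear:
  fixes a b :: "'n::finite \<Rightarrow> complex"
  shows "polydisc_algebra (\<lambda>z. \<Sum>j\<in>UNIV. a j + b j * z $ j)"
  unfolding polydisc_algebra_def
proof (intro conjI ballI allI)
  show "continuous_on closed_polydisc (\<lambda>z. \<Sum>j\<in>UNIV. a j + b j * z $ j)"
    by (intro continuous_intros)
next
  fix z :: "complex ^ 'n" and i
  have "(\<lambda>w. if j = i then w else z $ j) holomorphic_on ball 0 1" for j
    by (cases "j = i") (auto intro: holomorphic_intros)
  then show "(\<lambda>w. \<Sum>j\<in>UNIV. a j + b j * (\<chi> j. if j = i then w else z $ j) $ j) holomorphic_on ball 0 1"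
    unfolding vec_lambda_beta by (intro holomorphic_intros)
qed

lemma polydisc_algebra_const: "polydisc_algebra (\<lambda>_. c)"
  by (auto simp: polydisc_algebra_def)

lemma polydisc_algebra_herglotz:
  assumes F: "polydisc_algebra F" and b: "\<And>z. z \<in> closed_polydisc \<Longrightarrow> F z \<noteq> \<alpha>"
  shows "polydisc_algebra (\<lambda>z. (\<alpha> + F z) / (\<alpha> - F z))"
  unfolding polydisc_algebra_def
proof (intro conjI ballI allI)
  show "continuous_on closed_polydisc (\<lambda>z. (\<alpha> + F z) / (\<alpha> - F z))"
    using F b by (intro continuous_intros) (auto simp: polydisc_algebra_def)
next
  fix z :: "complex ^ 'a" and i assume z: "z \<in> closed_polydisc"
  let ?g = "\<lambda>w. F (\<chi> j. if j = i then w else z $ j)"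
  have "?g holomorphic_on ball 0 1"
    using F z by (simp add: polydisc_algebra_def)
  moreover have "?g w \<noteq> \<alpha>" if "w \<in> ball 0 1" for w
    using that z by (intro b closed_polydisc_update) auto
  ultimately show "(\<lambda>w. (\<alpha> + ?g w) / (\<alpha> - ?g w)) holomorphic_on ball 0 1"
    by (intro holomorphic_intros) auto
qed

lemma holomorphic_several_on_imp_continuous_on:
  "f holomorphic_several_on U \<Longrightarrow> continuous_on U f"
  unfolding holomorphic_several_on_def continuous_on_eq_continuous_within
  using has_derivative_continuous by blast

text \<open>Scaling by \<open>r < 1\<close> maps the closed polydisc into the open one, so
  continuity reaches the boundary. Holomorphy in one variable is the chain rule along an affine
  complex line.\<close>

lemma polydisc_algebra_dilation:
  fixes \<phi> :: "complex ^ 'n \<Rightarrow> complex"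
  assumes \<phi>: "\<phi> holomorphic_several_on polydisc" and r: "0 \<le> r" "r < 1"
  shows "polydisc_algebra (\<lambda>z. \<phi> (r *\<^sub>R z))"
  unfolding polydisc_algebra_def
proof (intro conjI ballI allI)
  show "continuous_on closed_polydisc (\<lambda>z. \<phi> (r *\<^sub>R z))"
    using scaleR_closed_polydisc r
    by (intro continuous_on_compose2[OF holomorphic_several_on_imp_continuous_on[OF \<phi>]]) (auto intro!: continuous_intros)
next
  fix z :: "complex ^ 'n" and i assume z: "z \<in> closed_polydisc"
  \<comment> \<open>\<open>L\<close> is the linear part of the affine map \<open>e\<close> that
    inserts \<open>w\<close> at coordinate \<open>i\<close> and scales by \<open>r\<close>.\<close>
  define L :: "complex \<Rightarrow> complex ^ 'n" where "L w = (of_real r * w) *s axis i 1" for w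
  define e where "e w = r *\<^sub>R (\<chi> j. if j = i then w else z $ j)" for w
  have "linear L"
    unfolding L_def by (rule linearI) (simp_all add: vec_eq_iff algebra_simps)
  then have L: "bounded_linear L"
    by (simp add: linear_conv_bounded_linear)
  have "e = (\<lambda>w. e 0 + L w)"
    by (intro ext) (simp add: e_def L_def vec_eq_iff axis_def scaleR_conv_of_real[where 'a = complex])
  moreover have "((\<lambda>w. e 0 + L w) has_derivative L) (at w within S)" for w S
    using has_derivative_add[OF has_derivative_const bounded_linear_imp_has_derivative[OF L]] by simp
  ultimately have e': "(e has_derivative L) (at w within S)" for w S
    by metis
  have sub: "e ` ball 0 1 \<subseteq> polydisc"
    unfolding e_def using z r by (auto intro!: scaleR_closed_polydisc closed_polydisc_update)
  show "(\<lambda>w. \<phi> (r *\<^sub>R (\<chi> j. if j = i then w else z $ j))) holomorphic_on ball 0 1"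
    unfolding holomorphic_on_def
  proof
    fix w :: complex assume w: "w \<in> ball 0 1"
    then obtain f' where f': "(\<phi> has_derivative f') (at (e w) within polydisc)" "\<And>c v. f' (c *s v) = c * f' v"
      using \<phi> sub unfolding holomorphic_several_on_def by blast
    have "((\<lambda>w. \<phi> (e w)) has_derivative (\<lambda>h. f' (L h))) (at w within ball 0 1)"
      by (rule has_derivative_in_compose[OF e' has_derivative_subset[OF f'(1) sub]])
    \<comment> \<open>Complex linearity of \<open>f'\<close> turns the composed derivative into
      multiplication by a complex number.\<close>
    moreover have "(\<lambda>h. f' (L h)) = (*) (of_real r * f' (axis i 1))"
      by (auto simp: L_def f'(2))
    ultimately show "(\<lambda>w. \<phi> (r *\<^sub>R (\<chi> j. if j = i then w else z $ j))) field_differentiable at w within ball 0 1"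
      unfolding e_def field_differentiable_def has_field_derivative_def by auto
  qed
qed

section \<open>Integrals against the Poisson kernel of the polydisc\<close>

lemma integrable_continuous_restrict_compact:
  fixes f :: "'a::t2_space \<Rightarrow> 'b::{banach, second_countable_topology}"
  assumes "finite_measure M" and M: "sets M = sets (restrict_space borel X)"
    and X: "compact X" and f: "continuous_on X f"
  shows "integrable M f"
proof -
  interpret finite_measure M by fact
  have sp: "space M = X"
    using sets_eq_imp_space_eq[OF M] by (simp add: space_restrict_space)
  obtain B where "\<And>x. x \<in> X \<Longrightarrow> norm (f x) \<le> B"
    using compact_imp_bounded[OF compact_continuous_image[OF f X]] by (auto simp: bounded_iff)
  then show ?thesis
    using borel_measurable_continuous_on_restrict[OF f]
    by (intro integrable_const_bound[where B = B]) (auto simp: sp measurable_cong_sets[OF M refl])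
qed

lemmas integrable_torus = integrable_continuous_restrict_compact[OF _ _ compact_torus]

lemma finite_measure_torus: "finite_measure torus_measure"
  using prob_space_torus_measure by (rule prob_space.finite_measure)

lemmas integrable_torus_measure = integrable_torus[OF finite_measure_torus sets_torus_measure]

lemma continuous_on_poisson_kernel:
  assumes "z \<in> polydisc" shows "continuous_on torus (poisson_kernel z)"
  unfolding poisson_kernel_eq_prod
  using assms by (intro continuous_intros) (auto simp: polydisc_def torus_def)

lemma poisson_kernel_nonneg: "z \<in> closed_polydisc \<Longrightarrow> 0 \<le> poisson_kernel z \<zeta>"
  unfolding poisson_kernel_eq_prod by (intro prod_nonneg poisson_disc_nonneg) (auto simp: closed_polydisc_def)

lemma poisson_kernel_0 [simp]: "poisson_kernel 0 \<zeta> = 1"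
  by (simp add: poisson_kernel_def)

lemma zero_in_polydisc: "0 \<in> polydisc"
  by (simp add: polydisc_def)

lemma poisson_kernel_scaleR_le:
  fixes \<eta> \<zeta> :: "complex ^ 'n"
  assumes "\<eta> \<in> torus" "\<zeta> \<in> torus" "0 \<le> r" "r < 1"
  shows "poisson_kernel (r *\<^sub>R \<eta>) \<zeta> \<le> (1 / (1 - r)\<^sup>2) ^ CARD('n)"
proof -
  have "poisson_kernel (r *\<^sub>R \<eta>) \<zeta> \<le> (\<Prod>j\<in>(UNIV::'n set). 1 / (1 - r)\<^sup>2)"
    unfolding poisson_kernel_eq_prod
  proof (intro prod_mono conjI)
    fix j :: 'n
    have "cmod ((r *\<^sub>R \<eta>) $ j) = r" "cmod (\<zeta> $ j) = 1"
      using assms by (auto simp: torus_def)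
    then show "0 \<le> poisson_disc ((r *\<^sub>R \<eta>) $ j) (\<zeta> $ j)"
      "poisson_disc ((r *\<^sub>R \<eta>) $ j) (\<zeta> $ j) \<le> 1 / (1 - r)\<^sup>2"
      using assms poisson_disc_le[of "(r *\<^sub>R \<eta>) $ j" "\<zeta> $ j"] by (auto intro: poisson_disc_nonneg)
  qed
  then show ?thesis by simp
qed

text \<open>Conjugating \<open>1 - r \<eta>_j cnj \<zeta>_j\<close> exchanges the two points without
  changing the modulus, and the numerators agree because all coordinates on the torus have modulus
  one.\<close>

lemma poisson_kernel_symmetric:
  assumes "\<eta> \<in> torus" "\<zeta> \<in> torus"
  shows "poisson_kernel (r *\<^sub>R \<eta>) \<zeta> = poisson_kernel (r *\<^sub>R \<zeta>) \<eta>"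
  unfolding poisson_kernel_def
proof (rule prod.cong)
  fix j
  have "cmod (1 - r *\<^sub>R \<eta> $ j * cnj (\<zeta> $ j)) = cmod (cnj (1 - r *\<^sub>R \<eta> $ j * cnj (\<zeta> $ j)))"
    by (rule complex_mod_cnj[symmetric])
  also have "cnj (1 - r *\<^sub>R \<eta> $ j * cnj (\<zeta> $ j)) = 1 - r *\<^sub>R \<zeta> $ j * cnj (\<eta> $ j)"
    by (simp add: mult.commute)
  finally show "(1 - (cmod ((r *\<^sub>R \<eta>) $ j))\<^sup>2) / (cmod (1 - (r *\<^sub>R \<eta>) $ j * cnj (\<zeta> $ j)))\<^sup>2 =
      (1 - (cmod ((r *\<^sub>R \<zeta>) $ j))\<^sup>2) / (cmod (1 - (r *\<^sub>R \<zeta>) $ j * cnj (\<eta> $ j)))\<^sup>2"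
    using assms by (simp add: torus_def)
qed simp

lemma poisson_formula_Re:
  fixes F :: "complex ^ 'n \<Rightarrow> complex"
  assumes F: "polydisc_algebra F" and z: "z \<in> polydisc"
  shows "(\<integral>\<zeta>. poisson_kernel z \<zeta> * Re (F \<zeta>) \<partial>torus_measure) = Re (F z)"
proof -
  have "continuous_on torus F"
    using F torus_subset_closed by (auto simp: polydisc_algebra_def intro: continuous_on_subset)
  then have "integrable torus_measure (\<lambda>\<zeta>. of_real (poisson_kernel z \<zeta>) * F \<zeta>)"
    using continuous_on_poisson_kernel[OF z]
    by (intro integrable_torus_measure continuous_intros)
  then have "Re (\<integral>\<zeta>. of_real (poisson_kernel z \<zeta>) * F \<zeta> \<partial>torus_measure) =
      (\<integral>\<zeta>. Re (of_real (poisson_kernel z \<zeta>) * F \<zeta>) \<partial>torus_measure)"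
    by (rule integral_Re[symmetric])
  then show ?thesis
    using poisson_formula_polydisc[OF F z] by simp
qed

text \<open>Multiplication by \<open>cnj \<alpha>\<close> preserves the modulus, so
  \<open>cmod (\<alpha> - w)\<close> equals \<open>cmod (1 - w * cnj \<alpha>)\<close>. The
  numerator is the real part of \<open>(\<alpha> + w) * cnj (\<alpha> - w)\<close>.\<close>

lemma Re_herglotz:
  assumes "cmod \<alpha> = 1"
  shows "Re ((\<alpha> + w) / (\<alpha> - w)) = poisson_disc w \<alpha>"
proof -
  have a: "\<alpha> * cnj \<alpha> = 1" using assms complex_norm_square[of \<alpha>] by simp
  have "cmod (\<alpha> - w) = cmod (cnj \<alpha> * (\<alpha> - w))"
    using assms by (simp add: norm_mult)
  also have "cnj \<alpha> * (\<alpha> - w) = 1 - w * cnj \<alpha>"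
    using a by (simp add: algebra_simps)
  finally have n: "cmod (\<alpha> - w) = cmod (1 - w * cnj \<alpha>)" .
  have "Re ((\<alpha> + w) * cnj (\<alpha> - w)) = (cmod \<alpha>)\<^sup>2 - (cmod w)\<^sup>2"
    unfolding cmod_power2 by (simp add: algebra_simps power2_eq_square)
  then show ?thesis
    unfolding complex_div_cnj[of "\<alpha> + w"] poisson_disc_def n[symmetric] using assms
    by (simp flip: of_real_power)
qed

text \<open>The function being reproduced is the real part of the Herglotz transform
  \<open>(\<alpha> + F) / (\<alpha> - F)\<close>, which stays in the polydisc algebra because
  \<open>F\<close> never reaches the circle.\<close>

lemma poisson_formula_herglotz:
  fixes F :: "complex ^ 'n \<Rightarrow> complex"
  assumes F: "polydisc_algebra F" "F ` closed_polydisc \<subseteq> ball 0 1" and z: "z \<in> polydisc" and \<alpha>: "cmod \<alpha> = 1"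
  shows "(\<integral>\<zeta>. poisson_kernel z \<zeta> * poisson_disc (F \<zeta>) \<alpha> \<partial>torus_measure) = poisson_disc (F z) \<alpha>"
proof -
  have "polydisc_algebra (\<lambda>z. (\<alpha> + F z) / (\<alpha> - F z))"
    using F \<alpha> by (intro polydisc_algebra_herglotz) auto
  from poisson_formula_Re[OF this z] show ?thesis
    using \<alpha> by (simp add: Re_herglotz)
qed

lemma poisson_kernel_integral:
  assumes "z \<in> polydisc" shows "(\<integral>\<zeta>. poisson_kernel z \<zeta> \<partial>torus_measure) = 1"
  using poisson_formula_Re[OF polydisc_algebra_const[of 1] assms] by simp

text \<open>On the torus, \<open>(norm (\<eta> - \<zeta>))\<^sup>2\<close> is the real part of the
  affine function \<open>F\<close>, the sum of \<open>2 - 2 cnj \<zeta>_j \<eta>_j\<close>.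
  Poisson's formula evaluates it at \<open>r *\<^sub>R \<zeta>\<close>.\<close>

lemma poisson_kernel_second_moment:
  fixes \<zeta> :: "complex ^ 'n" and r :: real
  assumes \<zeta>: "\<zeta> \<in> torus" and r: "0 \<le> r" "r < 1"
  shows "(\<integral>\<eta>. poisson_kernel (r *\<^sub>R \<zeta>) \<eta> * (norm (\<eta> - \<zeta>))\<^sup>2 \<partial>torus_measure) = CARD('n) * (2 - 2 * r)"
proof -
  define F :: "complex ^ 'n \<Rightarrow> complex" where "F \<eta> = (\<Sum>j\<in>UNIV. 2 + (- 2 * cnj (\<zeta> $ j)) * \<eta> $ j)" for \<eta>
  have F: "polydisc_algebra F"
    unfolding F_def by (rule polydisc_algebra_linear)
  have ReF: "Re (F \<eta>) = (norm (\<eta> - \<zeta>))\<^sup>2" if "\<eta> \<in> torus" for \<eta>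
  proof -
    have coord: "(cmod (\<eta> $ j - \<zeta> $ j))\<^sup>2 = Re (2 + (- 2 * cnj (\<zeta> $ j)) * \<eta> $ j)" for j
    proof -
      have "(cmod (\<eta> $ j))\<^sup>2 = 1" "(cmod (\<zeta> $ j))\<^sup>2 = 1"
        using that \<zeta> by (auto simp: torus_def)
      then show ?thesis
        unfolding cmod_power2 by (simp add: power2_eq_square algebra_simps)
    qed
    have "(norm (\<eta> - \<zeta>))\<^sup>2 = (\<Sum>j\<in>UNIV. (cmod (\<eta> $ j - \<zeta> $ j))\<^sup>2)"
      by (simp add: norm_vec_def L2_set_def sum_nonneg)
    then show ?thesis
      unfolding F_def by (simp only: Re_sum coord)
  qed
  have "(\<integral>\<eta>. poisson_kernel (r *\<^sub>R \<zeta>) \<eta> * (norm (\<eta> - \<zeta>))\<^sup>2 \<partial>torus_measure) =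
      (\<integral>\<eta>. poisson_kernel (r *\<^sub>R \<zeta>) \<eta> * Re (F \<eta>) \<partial>torus_measure)"
    by (intro Bochner_Integration.integral_cong refl) (simp add: ReF)
  also have "\<dots> = Re (F (r *\<^sub>R \<zeta>))"
    using \<zeta> r torus_subset_closed by (intro poisson_formula_Re F scaleR_closed_polydisc) auto
  also have "\<dots> = CARD('n) * (2 - 2 * r)"
  proof -
    have "\<zeta> $ j * cnj (\<zeta> $ j) = 1" for j
      using \<zeta> complex_norm_square[of "\<zeta> $ j"] by (simp add: torus_def)
    then have "(- 2 * cnj (\<zeta> $ j)) * (r *\<^sub>R \<zeta>) $ j = of_real (- 2 * r)" for j
      by (simp add: scaleR_conv_of_real[where 'a = complex] mult_ac)
    then show ?thesis
      unfolding F_def by (simp only: Re_sum) simp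
  qed
  finally show ?thesis .
qed

section \<open>Radial limits of Poisson integrals\<close>

text \<open>A fixed sequence increasing to one replaces the limit in \<open>r\<close>, so that
  dominated convergence for sequences applies.\<close>

definition radius :: "nat \<Rightarrow> real" where "radius k = real k / real (Suc k)"

lemma radius: "0 \<le> radius k" "radius k < 1"
  by (auto simp: radius_def)

lemma radius_tendsto: "radius \<longlonglongrightarrow> 1"
  unfolding radius_def by (rule LIMSEQ_n_over_Suc_n)

text \<open>Chebyshev's argument: by uniform continuity \<open>\<bar>f \<eta> - f \<zeta>\<bar> \<le> e + C \<bar>\<eta> - \<zeta>\<bar>\<^sup>2\<close>, and the second
  moment of the Poisson kernel about \<open>\<zeta>\<close> tends to zero.\<close>

lemma poisson_integral_radial_limit:
  fixes f :: "complex ^ 'n \<Rightarrow> complex"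
  assumes f: "continuous_on torus f" and \<zeta>: "\<zeta> \<in> torus"
  shows "(\<lambda>k. \<integral>\<eta>. of_real (poisson_kernel (radius k *\<^sub>R \<zeta>) \<eta>) * f \<eta> \<partial>torus_measure) \<longlonglongrightarrow> f \<zeta>"
proof (rule LIMSEQ_I)
  fix e :: real assume e: "e > 0"
  let ?P = "\<lambda>k. poisson_kernel (radius k *\<^sub>R \<zeta>)"
  have pd: "radius k *\<^sub>R \<zeta> \<in> polydisc" for k
    using \<zeta> torus_subset_closed radius by (intro scaleR_closed_polydisc) auto
  note contP = continuous_on_poisson_kernel[OF pd]
  have P0: "0 \<le> ?P k \<eta>" for k \<eta>
    using pd polydisc_subset_closed by (intro poisson_kernel_nonneg) auto
  obtain B where B: "\<And>x. x \<in> torus \<Longrightarrow> cmod (f x) \<le> B"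
    using compact_imp_bounded[OF compact_continuous_image[OF f compact_torus]] by (auto simp: bounded_iff)
  have "B \<ge> 0" using B[OF \<zeta>] norm_ge_zero order_trans by blast
  have "uniformly_continuous_on torus f"
    using compact_uniformly_continuous[OF f compact_torus] .
  then obtain d where d: "d > 0" "\<And>\<eta>. \<eta> \<in> torus \<Longrightarrow> dist \<eta> \<zeta> < d \<Longrightarrow> dist (f \<eta>) (f \<zeta>) < e / 2"
    using \<zeta> e unfolding uniformly_continuous_on_def by (metis dist_commute half_gt_zero)
  \<comment> \<open>Then \<open>C * d\<^sup>2 = 2 * B\<close>, which bounds the oscillation of
    \<open>f\<close> at points at distance \<open>d\<close> or more from \<zeta>.\<close>
  define C where "C = 2 * B / d\<^sup>2"
  have est: "cmod (f \<eta> - f \<zeta>) \<le> e / 2 + C * (norm (\<eta> - \<zeta>))\<^sup>2" if "\<eta> \<in> torus" for \<eta>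
  proof (cases "dist \<eta> \<zeta> < d")
    case True
    have "0 \<le> C" using \<open>B \<ge> 0\<close> d by (simp add: C_def)
    then have "0 \<le> C * (norm (\<eta> - \<zeta>))\<^sup>2" by simp
    then show ?thesis using d(2)[OF that True] unfolding dist_norm by linarith
  next
    case False
    then have "d\<^sup>2 \<le> (norm (\<eta> - \<zeta>))\<^sup>2"
      using d(1) by (intro power_mono) (auto simp: dist_norm)
    then have "2 * B \<le> C * (norm (\<eta> - \<zeta>))\<^sup>2"
      using \<open>B \<ge> 0\<close> d(1) mult_left_mono[of "d\<^sup>2" "(norm (\<eta> - \<zeta>))\<^sup>2" "2 * B"]
      by (simp add: C_def field_simps)
    moreover have "cmod (f \<eta> - f \<zeta>) \<le> 2 * B"
      using norm_triangle_ineq4[of "f \<eta>" "f \<zeta>"] B[OF that] B[OF \<zeta>] by linarith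
    ultimately show ?thesis using e by linarith
  qed
  define b where "b k = C * (real CARD('n) * (2 - 2 * radius k))" for k
  have bound: "cmod ((\<integral>\<eta>. of_real (?P k \<eta>) * f \<eta> \<partial>torus_measure) - f \<zeta>) \<le> e / 2 + b k" for k
  proof -
    have i: "integrable torus_measure (\<lambda>\<eta>. of_real (?P k \<eta>) * f \<eta>)"
      "integrable torus_measure (\<lambda>\<eta>. of_real (?P k \<eta>) * f \<zeta>)"
      "integrable torus_measure (\<lambda>\<eta>. ?P k \<eta> * (norm (\<eta> - \<zeta>))\<^sup>2)"
      "integrable torus_measure (?P k)"
      using contP f by (auto intro!: integrable_torus_measure continuous_intros)
    \<comment> \<open>The kernel has mass one, so the error becomes the integral of
      \<open>f \<eta> - f \<zeta>\<close> against it.\<close>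
    have "(\<integral>\<eta>. of_real (?P k \<eta>) * f \<zeta> \<partial>torus_measure) = f \<zeta>"
      using poisson_formula_polydisc[OF polydisc_algebra_const pd] .
    then have "(\<integral>\<eta>. of_real (?P k \<eta>) * f \<eta> \<partial>torus_measure) - f \<zeta> =
        (\<integral>\<eta>. of_real (?P k \<eta>) * f \<eta> - of_real (?P k \<eta>) * f \<zeta> \<partial>torus_measure)"
      using i by (subst Bochner_Integration.integral_diff) simp_all
    also have "cmod \<dots> \<le> (\<integral>\<eta>. e / 2 * ?P k \<eta> + C * (?P k \<eta> * (norm (\<eta> - \<zeta>))\<^sup>2) \<partial>torus_measure)"
    proof (rule order_trans[OF integral_norm_bound], rule integral_mono)
      fix \<eta> assume "\<eta> \<in> space (torus_measure :: (complex ^ 'n) measure)"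
      then have "?P k \<eta> * cmod (f \<eta> - f \<zeta>) \<le> ?P k \<eta> * (e / 2 + C * (norm (\<eta> - \<zeta>))\<^sup>2)"
        using est P0 by (intro mult_left_mono) auto
      also have "?P k \<eta> * cmod (f \<eta> - f \<zeta>) = cmod (of_real (?P k \<eta>) * (f \<eta> - f \<zeta>))"
        using P0 by (simp add: norm_mult)
      finally show "cmod (of_real (?P k \<eta>) * f \<eta> - of_real (?P k \<eta>) * f \<zeta>) \<le>
          e / 2 * ?P k \<eta> + C * (?P k \<eta> * (norm (\<eta> - \<zeta>))\<^sup>2)"
        by (simp add: algebra_simps)
    qed (use i in simp_all)
    also have "\<dots> = e / 2 * (\<integral>\<eta>. ?P k \<eta> \<partial>torus_measure) +
        C * (\<integral>\<eta>. ?P k \<eta> * (norm (\<eta> - \<zeta>))\<^sup>2 \<partial>torus_measure)"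
      using i by (subst Bochner_Integration.integral_add) simp_all
    also have "\<dots> = e / 2 + b k"
      by (simp only: poisson_kernel_integral[OF pd] poisson_kernel_second_moment[OF \<zeta> radius] b_def mult_1_right)
    finally show ?thesis .
  qed
  have "b \<longlonglongrightarrow> C * (real CARD('n) * (2 - 2 * 1))"
    unfolding b_def by (intro tendsto_intros radius_tendsto)
  then have "b \<longlonglongrightarrow> 0" by simp
  then obtain K where K: "\<And>k. k \<ge> K \<Longrightarrow> norm (b k - 0) < e / 2"
    using e by (metis LIMSEQ_D half_gt_zero)
  show "\<exists>K. \<forall>k\<ge>K. cmod ((\<integral>\<eta>. of_real (?P k \<eta>) * f \<eta> \<partial>torus_measure) - f \<zeta>) < e"
  proof (intro exI[of _ K] allI impI)
    fix k assume "k \<ge> K"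
    with K have "b k < e / 2" by fastforce
    with bound[of k] show "cmod ((\<integral>\<eta>. of_real (?P k \<eta>) * f \<eta> \<partial>torus_measure) - f \<zeta>) < e"
      by linarith
  qed
qed

section \<open>Uniqueness of the measure with a given Poisson integral\<close>

text \<open>For \<open>\<eta>, \<zeta>\<close> on the torus \<open>P(r\<eta>, \<zeta>) = P(r\<zeta>, \<eta>)\<close>, so Fubini moves the Poisson integral from
  \<open>\<sigma>\<close> to \<open>f\<close>.\<close>

lemma integral_poisson_integral_limit:
  fixes f :: "complex ^ 'n \<Rightarrow> complex"
  assumes \<sigma>: "finite_measure \<sigma>" "sets \<sigma> = sets (restrict_space borel torus)"
    and f: "continuous_on torus f"
  shows "(\<lambda>k. \<integral>\<eta>. f \<eta> * of_real (poisson_integral \<sigma> (radius k *\<^sub>R \<eta>)) \<partial>torus_measure)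
    \<longlonglongrightarrow> (\<integral>\<zeta>. f \<zeta> \<partial>\<sigma>)"
proof -
  interpret S: finite_measure \<sigma> by fact
  interpret T: prob_space "torus_measure :: (complex ^ 'n) measure" by (rule prob_space_torus_measure)
  interpret TS: pair_sigma_finite "torus_measure :: (complex ^ 'n) measure" \<sigma> ..
  interpret TSf: finite_measure "(torus_measure :: (complex ^ 'n) measure) \<Otimes>\<^sub>M \<sigma>"
    by (intro finite_measure_pair_measure S.finite_measure_axioms T.finite_measure_axioms)
  have sp: "space \<sigma> = torus"
    using sets_eq_imp_space_eq[OF \<sigma>(2)] by (simp add: space_restrict_space)
  have [measurable_cong]: "sets \<sigma> = sets (restrict_space borel torus)" by (rule \<sigma>(2))
  note [measurable] = id_borel_restrict
  have [measurable]: "f \<in> borel_measurable (restrict_space borel torus)"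
    using f by (rule borel_measurable_continuous_on_restrict)
  obtain B where B: "\<And>x. x \<in> torus \<Longrightarrow> cmod (f x) \<le> B" "0 \<le> B"
    using compact_imp_bounded[OF compact_continuous_image[OF f compact_torus]]
    unfolding bounded_pos by (metis imageI less_imp_le)
  \<comment> \<open>\<open>Q k\<close> is the Poisson integral of \<open>f\<close> on the torus of
    radius \<open>radius k\<close>. It is bounded by \<open>B\<close> and converges pointwise to
    \<open>f\<close>, so dominated convergence applies under \<sigma>.\<close>
  define Q where "Q k \<zeta> = (\<integral>\<eta>. of_real (poisson_kernel (radius k *\<^sub>R \<zeta>) \<eta>) * f \<eta> \<partial>torus_measure)" for k \<zeta>
  have pd: "radius k *\<^sub>R \<zeta> \<in> polydisc" if "\<zeta> \<in> torus" for k and \<zeta> :: "complex ^ 'n"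
    using that torus_subset_closed radius by (intro scaleR_closed_polydisc) auto
  have P0: "0 \<le> poisson_kernel (radius k *\<^sub>R \<zeta>) \<eta>" if "\<zeta> \<in> torus" for k \<zeta> and \<eta> :: "complex ^ 'n"
    using pd[OF that] polydisc_subset_closed by (intro poisson_kernel_nonneg) auto
  have swap: "(\<integral>\<eta>. f \<eta> * of_real (poisson_integral \<sigma> (radius k *\<^sub>R \<eta>)) \<partial>torus_measure) = (\<integral>\<zeta>. Q k \<zeta> \<partial>\<sigma>)" for k
  proof -
    let ?K = "\<lambda>\<eta> \<zeta>. f \<eta> * of_real (poisson_kernel (radius k *\<^sub>R \<eta>) \<zeta>)"
    have int: "integrable (torus_measure \<Otimes>\<^sub>M \<sigma>) (\<lambda>(\<eta>, \<zeta>). ?K \<eta> \<zeta>)"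
    proof (rule TSf.integrable_const_bound[where B = "B * (1 / (1 - radius k)\<^sup>2) ^ CARD('n)"])
      show "(\<lambda>(\<eta>, \<zeta>). ?K \<eta> \<zeta>) \<in> borel_measurable (torus_measure \<Otimes>\<^sub>M \<sigma>)"
        by measurable
      show "AE x in torus_measure \<Otimes>\<^sub>M \<sigma>. norm (case x of (\<eta>, \<zeta>) \<Rightarrow> ?K \<eta> \<zeta>) \<le> B * (1 / (1 - radius k)\<^sup>2) ^ CARD('n)"
      proof (rule AE_I2, clarsimp simp: space_pair_measure sp norm_mult)
        fix \<eta> \<zeta> :: "complex ^ 'n" assume "\<eta> \<in> torus" "\<zeta> \<in> torus"
        then have "cmod (f \<eta>) * \<bar>poisson_kernel (radius k *\<^sub>R \<eta>) \<zeta>\<bar> \<le> B * (1 / (1 - radius k)\<^sup>2) ^ CARD('n)"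
          using B P0[of \<eta> k \<zeta>] poisson_kernel_scaleR_le[of \<eta> \<zeta> "radius k"] radius[of k]
          by (intro mult_mono) auto
        then show "cmod (f \<eta>) * \<bar>poisson_kernel (radius k *\<^sub>R \<eta>) \<zeta>\<bar> \<le> B * (1 / (1 - radius k)\<^sup>2) ^ CARD('n)" .
      qed
    qed
    have "f \<eta> * of_real (poisson_integral \<sigma> (radius k *\<^sub>R \<eta>)) = (\<integral>\<zeta>. ?K \<eta> \<zeta> \<partial>\<sigma>)" for \<eta>
      unfolding poisson_integral_def by simp
    then have "(\<integral>\<eta>. f \<eta> * of_real (poisson_integral \<sigma> (radius k *\<^sub>R \<eta>)) \<partial>torus_measure) =
        (\<integral>\<eta>. \<integral>\<zeta>. ?K \<eta> \<zeta> \<partial>\<sigma> \<partial>torus_measure)"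
      by (simp only:)
    also have "\<dots> = (\<integral>\<zeta>. \<integral>\<eta>. ?K \<eta> \<zeta> \<partial>torus_measure \<partial>\<sigma>)"
      by (rule TS.Fubini_integral[OF int, symmetric])
    also have "\<dots> = (\<integral>\<zeta>. Q k \<zeta> \<partial>\<sigma>)"
      unfolding Q_def
      by (intro Bochner_Integration.integral_cong refl)
        (simp add: sp poisson_kernel_symmetric mult.commute)
    finally show ?thesis .
  qed
  have "(\<lambda>k. \<integral>\<zeta>. Q k \<zeta> \<partial>\<sigma>) \<longlonglongrightarrow> (\<integral>\<zeta>. f \<zeta> \<partial>\<sigma>)"
  proof (rule integral_dominated_convergence[where w = "\<lambda>_. B"])
    show "Q k \<in> borel_measurable \<sigma>" for k
      unfolding Q_def by measurable
    show "AE \<zeta> in \<sigma>. (\<lambda>k. Q k \<zeta>) \<longlonglongrightarrow> f \<zeta>"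
      unfolding Q_def using poisson_integral_radial_limit[OF f] by (intro AE_I2) (simp add: sp)
    show "AE \<zeta> in \<sigma>. norm (Q k \<zeta>) \<le> B" for k
    proof (rule AE_I2)
      fix \<zeta> assume "\<zeta> \<in> space \<sigma>"
      then have \<zeta>: "\<zeta> \<in> torus" by (simp add: sp)
      have "norm (Q k \<zeta>) \<le> (\<integral>\<eta>. B * poisson_kernel (radius k *\<^sub>R \<zeta>) \<eta> \<partial>torus_measure)"
        unfolding Q_def
      proof (rule order_trans[OF integral_norm_bound], rule integral_mono)
        show "integrable torus_measure (\<lambda>\<eta>. cmod (of_real (poisson_kernel (radius k *\<^sub>R \<zeta>) \<eta>) * f \<eta>))"
          "integrable torus_measure (\<lambda>\<eta>. B * poisson_kernel (radius k *\<^sub>R \<zeta>) \<eta>)"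
          using continuous_on_poisson_kernel[OF pd[OF \<zeta>]] f
          by (auto intro!: integrable_torus_measure continuous_intros)
        fix \<eta> assume "\<eta> \<in> space (torus_measure :: (complex ^ 'n) measure)"
        then show "cmod (of_real (poisson_kernel (radius k *\<^sub>R \<zeta>) \<eta>) * f \<eta>) \<le> B * poisson_kernel (radius k *\<^sub>R \<zeta>) \<eta>"
          using B P0[OF \<zeta>, of k \<eta>] by (simp add: norm_mult mult.commute mult_right_mono)
      qed
      also have "\<dots> = B"
        using poisson_kernel_integral[OF pd[OF \<zeta>]] by simp
      finally show "norm (Q k \<zeta>) \<le> B" .
    qed
  qed simp_all
  then show ?thesis
    by (simp add: swap)
qed

section \<open>Finite measures determined by continuous functions\<close>

text \<open>The indicator of a nonempty closed set is the pointwise limit of the continuous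
  functions \<open>max 0 (1 - n * infdist x C)\<close>. So both measures agree on closed subsets of
  \<open>X\<close>, an intersection-stable generator.\<close>

lemma finite_measure_eqI_continuous:
  fixes M N :: "'a::metric_space measure"
  assumes M: "finite_measure M" "sets M = sets (restrict_space borel X)"
    and N: "finite_measure N" "sets N = sets (restrict_space borel X)"
    and X: "closed X"
    and eq: "\<And>f :: 'a \<Rightarrow> real. continuous_on UNIV f \<Longrightarrow> (\<integral>x. f x \<partial>M) = (\<integral>x. f x \<partial>N)"
  shows "M = N"
proof -
  interpret M: finite_measure M by fact
  interpret N: finite_measure N by fact
  have spM: "space M = X" and spN: "space N = X"
    using sets_eq_imp_space_eq[OF M(2)] sets_eq_imp_space_eq[OF N(2)]
    by (auto simp: space_restrict_space)
  define E where "E = {C. closed C \<and> C \<subseteq> X}"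
  \<comment> \<open>Because \<open>X\<close> is closed, the traces of closed sets on
    \<open>X\<close> are exactly the closed subsets of \<open>X\<close>.\<close>
  have E_image: "E = (\<inter>) X ` {C. closed C}"
    using X by (auto simp: E_def image_iff)
  have sets_X: "sets (restrict_space borel X) = sigma_sets X E"
    unfolding sets_restrict_space E_image borel_eq_closed
    using X by (simp add: sigma_sets_Int sigma_sets.Basic)
  have E_sets: "C \<in> sets (restrict_space borel X)" if "C \<in> E" for C
    using that unfolding sets_X by (rule sigma_sets.Basic)
  have lim: "(\<lambda>n. \<integral>x. max 0 (1 - real n * infdist x C) \<partial>L) \<longlonglongrightarrow> measure L C"
    if "finite_measure L" and L: "sets L = sets (restrict_space borel X)" and C: "C \<in> E" "C \<noteq> {}" for L C
  proof -
    interpret L: finite_measure L by fact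
    have [measurable]: "C \<in> sets L" using E_sets[OF C(1)] L by simp
    have "(\<lambda>n. \<integral>x. max 0 (1 - real n * infdist x C) \<partial>L) \<longlonglongrightarrow> (\<integral>x. indicator C x \<partial>L)"
    proof (rule integral_dominated_convergence[where w = "\<lambda>_. 1"])
      show "(\<lambda>x. max 0 (1 - real n * infdist x C)) \<in> borel_measurable L" for n
      proof -
        have "(\<lambda>x. max 0 (1 - real n * infdist x C)) \<in> borel_measurable borel"
          by (intro borel_measurable_continuous_onI continuous_intros)
        then show ?thesis
          unfolding measurable_cong_sets[OF L refl] by (rule measurable_restrict_space1)
      qed
      show "AE x in L. (\<lambda>n. max 0 (1 - real n * infdist x C)) \<longlonglongrightarrow> indicator C x"
      proof (rule AE_I2)
        fix x
        show "(\<lambda>n. max 0 (1 - real n * infdist x C)) \<longlonglongrightarrow> indicator C x"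
        proof (cases "x \<in> C")
          case False
          then have "infdist x C > 0"
            using C in_closed_iff_infdist_zero[of C x] infdist_nonneg[of x C] by (auto simp: E_def less_le)
          then obtain K where K: "1 < real K * infdist x C"
            using reals_Archimedean3 by blast
          have "max 0 (1 - real n * infdist x C) = 0" if "n \<ge> K" for n
            using K mult_right_mono[of "real K" "real n" "infdist x C"] that infdist_nonneg[of x C] by simp
          then have "\<forall>\<^sub>F n in sequentially. max 0 (1 - real n * infdist x C) = indicator C x"
            using False by (auto simp: eventually_sequentially)
          then show ?thesis by (rule tendsto_eventually)
        qed (simp add: infdist_zero)
      qed
      show "AE x in L. norm (max 0 (1 - real n * infdist x C)) \<le> 1" for n
        by (intro AE_I2) (simp add: infdist_nonneg)
    qed simp_all
    then show ?thesis by simp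
  qed
  \<comment> \<open>By convention \<open>infdist x {} = 0\<close>, so the approximation fails for
    the empty set, which is treated apart.\<close>
  have em: "emeasure M C = emeasure N C" if C: "C \<in> E" for C
  proof (cases "C = {}")
    case False
    have "(\<integral>x. max 0 (1 - real n * infdist x C) \<partial>M) = (\<integral>x. max 0 (1 - real n * infdist x C) \<partial>N)" for n
      by (intro eq continuous_intros)
    then have "measure M C = measure N C"
      using lim[OF M C False] lim[OF N C False] by (simp add: LIMSEQ_unique)
    then show ?thesis
      by (simp add: M.emeasure_eq_measure N.emeasure_eq_measure)
  qed simp
  show ?thesis
  proof (rule measure_eqI_generator_eq[where E = E and \<Omega> = X and A = "\<lambda>_. X"])
    show "Int_stable E" by (auto simp: Int_stable_def E_def)
    show "E \<subseteq> Pow X" by (auto simp: E_def)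
    show "sets M = sigma_sets X E" "sets N = sigma_sets X E"
      using M N sets_X by simp_all
    show "range (\<lambda>_::nat. X) \<subseteq> E" using X by (auto simp: E_def)
    show "emeasure M X \<noteq> \<infinity>" using M.emeasure_finite by simp
  qed (simp_all add: em)
qed

text \<open>The integral of a continuous function is a limit of expressions that involve the measure
  only through its Poisson integral at the points \<open>radius k *\<^sub>R \<eta>\<close>.\<close>

lemma poisson_integral_inject:
  fixes \<sigma> \<tau> :: "(complex ^ 'n) measure"
  assumes \<sigma>: "finite_measure \<sigma>" "sets \<sigma> = sets (restrict_space borel torus)"
    and \<tau>: "finite_measure \<tau>" "sets \<tau> = sets (restrict_space borel torus)"
    and eq: "\<And>z. z \<in> polydisc \<Longrightarrow> poisson_integral \<sigma> z = poisson_integral \<tau> z"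
  shows "\<sigma> = \<tau>"
proof (rule finite_measure_eqI_continuous[OF \<sigma> \<tau> compact_imp_closed[OF compact_torus]])
  fix f :: "complex ^ 'n \<Rightarrow> real" assume "continuous_on UNIV f"
  then have f: "continuous_on torus (\<lambda>x. complex_of_real (f x))"
    by (auto intro!: continuous_intros intro: continuous_on_subset)
  have "poisson_integral \<sigma> (radius k *\<^sub>R \<eta>) = poisson_integral \<tau> (radius k *\<^sub>R \<eta>)" if "\<eta> \<in> torus" for k \<eta>
    using that torus_subset_closed radius by (intro eq scaleR_closed_polydisc) auto
  then have "(\<integral>\<eta>. of_real (f \<eta>) * complex_of_real (poisson_integral \<sigma> (radius k *\<^sub>R \<eta>)) \<partial>torus_measure) =
      (\<integral>\<eta>. of_real (f \<eta>) * complex_of_real (poisson_integral \<tau> (radius k *\<^sub>R \<eta>)) \<partial>torus_measure)" for k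
    by (intro Bochner_Integration.integral_cong refl) simp
  then have "(\<integral>\<zeta>. complex_of_real (f \<zeta>) \<partial>\<sigma>) = (\<integral>\<zeta>. complex_of_real (f \<zeta>) \<partial>\<tau>)"
    using LIMSEQ_unique[OF integral_poisson_integral_limit[OF \<sigma> f]]
      integral_poisson_integral_limit[OF \<tau> f] by simp
  then show "(\<integral>\<zeta>. f \<zeta> \<partial>\<sigma>) = (\<integral>\<zeta>. f \<zeta> \<partial>\<tau>)"
    by simp
qed

section \<open>Clark measures\<close>

lemma dilation_in_polydisc:
  assumes "\<zeta> \<in> torus" shows "radius k *\<^sub>R \<zeta> \<in> polydisc"
  using assms torus_subset_closed radius by (intro scaleR_closed_polydisc) auto

lemma scaleR_polydisc:
  assumes "z \<in> polydisc" shows "radius k *\<^sub>R z \<in> polydisc"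
  using assms polydisc_subset_closed radius by (intro scaleR_closed_polydisc) auto

text \<open>The measures with density \<open>u (radius k *\<^sub>R \<zeta>) / c\<close> have Poisson
  integral \<open>u (radius k *\<^sub>R z) / c\<close>. A weak limit of a subsequence has Poisson
  integral \<open>u z / c\<close> by continuity of \<open>u\<close>, and multiplying it by
  \<open>c\<close> gives the Clark measure.\<close>

lemma clark_measure_exists:
  fixes \<phi> :: "complex ^ 'n \<Rightarrow> complex"
  assumes \<phi>: "\<phi> holomorphic_several_on polydisc" "\<phi> ` polydisc \<subseteq> ball 0 1"
    and \<alpha>: "cmod \<alpha> = 1"
  shows "\<exists>\<sigma>. is_clark_measure \<phi> \<alpha> \<sigma>"
proof -
  have \<phi>_lt: "cmod (\<phi> z) < 1" if "z \<in> polydisc" for z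
    using \<phi>(2) that by auto
  define u where "u z = poisson_disc (\<phi> z) \<alpha>" for z
  have contu: "continuous_on polydisc u"
    unfolding u_def using holomorphic_several_on_imp_continuous_on[OF \<phi>(1)] \<phi>_lt \<alpha>
    by (intro continuous_intros) auto
  have u_pos: "0 < u z" if "z \<in> polydisc" for z
    using \<phi>_lt[OF that] poisson_denominator_nonzero[of "\<phi> z" \<alpha>] \<alpha>
    by (auto simp: u_def poisson_disc_def power_less_one_iff abs_square_less_1 intro!: divide_pos_pos)
  \<comment> \<open>The common mass of the undivided densities, by Poisson's formula at the origin;
    dividing by it gives probability measures.\<close>
  define c where "c = u 0"
  have c: "c > 0" using u_pos[OF zero_in_polydisc] by (simp add: c_def)
  have poisson: "(\<integral>\<zeta>. poisson_kernel z \<zeta> * u (radius k *\<^sub>R \<zeta>) \<partial>torus_measure) = u (radius k *\<^sub>R z)"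
    if "z \<in> polydisc" for k z
    unfolding u_def
  proof (rule poisson_formula_herglotz[OF polydisc_algebra_dilation[OF \<phi>(1) radius] _ that \<alpha>])
    show "(\<lambda>z. \<phi> (radius k *\<^sub>R z)) ` closed_polydisc \<subseteq> ball 0 1"
      by (auto intro!: \<phi>_lt scaleR_closed_polydisc radius)
  qed
  have contuk: "continuous_on torus (\<lambda>\<zeta>. u (radius k *\<^sub>R \<zeta>))" for k
    by (intro continuous_on_compose2[OF contu] continuous_intros) (auto simp: dilation_in_polydisc)
  have uk_meas: "(\<lambda>\<zeta>. u (radius k *\<^sub>R \<zeta>)) \<in> borel_measurable torus_measure" for k
    using borel_measurable_continuous_on_restrict[OF contuk] by (simp cong: measurable_cong_sets)
  define M :: "nat \<Rightarrow> (complex ^ 'n) measure"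
    where "M k = density torus_measure (\<lambda>\<zeta>. ennreal (u (radius k *\<^sub>R \<zeta>) / c))" for k
  have uk_nonneg: "AE \<zeta> in torus_measure. 0 \<le> u (radius k *\<^sub>R \<zeta>) / c" for k
    using u_pos[OF dilation_in_polydisc] c by (intro AE_I2) (simp add: less_imp_le)
  have M_prob: "prob_space (M k)" for k
  proof (rule prob_spaceI)
    have i: "integrable torus_measure (\<lambda>\<zeta>. u (radius k *\<^sub>R \<zeta>) / c)"
      using contuk c by (intro integrable_torus_measure continuous_intros) auto
    have "(\<integral>\<zeta>. u (radius k *\<^sub>R \<zeta>) / c \<partial>torus_measure) = 1"
      using poisson[OF zero_in_polydisc, of k] c by (simp add: c_def)
    then have "(\<integral>\<^sup>+\<zeta>. ennreal (u (radius k *\<^sub>R \<zeta>) / c) \<partial>torus_measure) = 1"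
      using nn_integral_eq_integral[OF i uk_nonneg] by simp
    moreover have "emeasure (M k) (space (M k)) =
        (\<integral>\<^sup>+\<zeta>. ennreal (u (radius k *\<^sub>R \<zeta>) / c) * indicator (space torus_measure) \<zeta> \<partial>torus_measure)"
      unfolding M_def space_density using uk_meas by (intro emeasure_density sets.top) simp
    moreover have "\<dots> = (\<integral>\<^sup>+\<zeta>. ennreal (u (radius k *\<^sub>R \<zeta>) / c) \<partial>torus_measure)"
      by (intro nn_integral_cong) simp
    ultimately show "emeasure (M k) (space (M k)) = 1" by simp
  qed
  have M_sets: "sets (M k) = sets (restrict_space borel torus)" for k
    by (simp add: M_def)
  have "(torus :: (complex ^ 'n) set) \<noteq> {}"
    using prob_space.not_empty[OF prob_space_torus_measure] by simp
  then obtain s \<mu> where s: "strict_mono s" and \<mu>: "prob_space \<mu>" "sets \<mu> = sets (restrict_space borel torus)"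
    and lim: "\<And>f :: complex ^ 'n \<Rightarrow> real. continuous_on torus f \<Longrightarrow>
      (\<lambda>k. \<integral>\<zeta>. f \<zeta> \<partial>M (s k)) \<longlonglongrightarrow> (\<integral>\<zeta>. f \<zeta> \<partial>\<mu>)"
    using prob_measures_sequentially_compact[where M = M and X = torus] compact_torus M_prob M_sets by metis
  interpret \<mu>: prob_space \<mu> by (rule \<mu>)
  define \<sigma> where "\<sigma> = density \<mu> (\<lambda>_. ennreal c)"
  have "is_clark_measure \<phi> \<alpha> \<sigma>"
    unfolding is_clark_measure_def
  proof (intro conjI ballI)
    show "sets \<sigma> = sets (restrict_space borel torus)"
      using \<mu> by (simp add: \<sigma>_def)
    show "finite_measure \<sigma>"
      by (intro finite_measureI) (simp add: \<sigma>_def emeasure_density_const ennreal_mult_eq_top_iff)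
    fix z :: "complex ^ 'n" assume z: "z \<in> polydisc"
    have contP: "continuous_on torus (poisson_kernel z)"
      using z by (rule continuous_on_poisson_kernel)
    have P_meas: "poisson_kernel z \<in> borel_measurable torus_measure"
      using borel_measurable_continuous_on_restrict[OF contP] by (simp cong: measurable_cong_sets)
    have "(\<integral>\<zeta>. poisson_kernel z \<zeta> \<partial>M k) = u (radius k *\<^sub>R z) / c" for k
    proof -
      have "(\<integral>\<zeta>. poisson_kernel z \<zeta> \<partial>M k) =
          (\<integral>\<zeta>. (u (radius k *\<^sub>R \<zeta>) / c) *\<^sub>R poisson_kernel z \<zeta> \<partial>torus_measure)"
        unfolding M_def using uk_meas P_meas uk_nonneg by (intro integral_density) auto
      also have "\<dots> = (\<integral>\<zeta>. poisson_kernel z \<zeta> * u (radius k *\<^sub>R \<zeta>) / c \<partial>torus_measure)"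
        by (simp add: mult.commute)
      also have "\<dots> = u (radius k *\<^sub>R z) / c"
        using poisson[OF z] by simp
      finally show ?thesis .
    qed
    \<comment> \<open>For fixed \<open>z\<close> in the open polydisc the kernel is continuous on
      the torus, hence a legitimate test function.\<close>
    then have "(\<lambda>k. u (radius (s k) *\<^sub>R z) / c) \<longlonglongrightarrow> (\<integral>\<zeta>. poisson_kernel z \<zeta> \<partial>\<mu>)"
      using lim[OF contP] by simp
    moreover have "(\<lambda>k. u (radius (s k) *\<^sub>R z) / c) \<longlonglongrightarrow> u z / c"
    proof -
      have "(\<lambda>k. radius (s k)) \<longlonglongrightarrow> 1"
        using LIMSEQ_subseq_LIMSEQ[OF radius_tendsto s] by (simp add: o_def)
      then have "(\<lambda>k. radius (s k) *\<^sub>R z) \<longlonglongrightarrow> 1 *\<^sub>R z"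
        by (intro tendsto_intros)
      then have "(\<lambda>k. u (radius (s k) *\<^sub>R z)) \<longlonglongrightarrow> u z"
        using z by (intro continuous_on_tendsto_compose[OF contu]) (auto simp: scaleR_polydisc)
      then show ?thesis
        using c by (intro tendsto_intros) auto
    qed
    ultimately have "(\<integral>\<zeta>. poisson_kernel z \<zeta> \<partial>\<mu>) = u z / c"
      by (rule LIMSEQ_unique)
    moreover have "poisson_integral \<sigma> z = c * (\<integral>\<zeta>. poisson_kernel z \<zeta> \<partial>\<mu>)"
      unfolding poisson_integral_def \<sigma>_def
      using c P_meas \<mu>(2) by (subst integral_density) (auto cong: measurable_cong_sets)
    ultimately show "poisson_integral \<sigma> z = Re ((\<alpha> + \<phi> z) / (\<alpha> - \<phi> z))"
      using c \<alpha> by (simp add: u_def Re_herglotz)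
  qed
  then show ?thesis ..
qed

text \<open>Existence together with \<open>poisson_integral_inject\<close> makes the definite
  description in \<open>clark_measure\<close> meaningful.\<close>

lemma is_clark_measure_clark_measure:
  fixes \<phi> :: "complex ^ 'n \<Rightarrow> complex"
  assumes "\<phi> holomorphic_several_on polydisc" "\<phi> ` polydisc \<subseteq> ball 0 1" "cmod \<alpha> = 1"
  shows "is_clark_measure \<phi> \<alpha> (clark_measure \<phi> \<alpha>)"
  unfolding clark_measure_def
proof (rule theI')
  obtain \<sigma> where "is_clark_measure \<phi> \<alpha> \<sigma>"
    using clark_measure_exists[OF assms] ..
  moreover have "\<tau> = \<sigma>" if "is_clark_measure \<phi> \<alpha> \<tau>" for \<tau>
    using that \<open>is_clark_measure \<phi> \<alpha> \<sigma>\<close> unfolding is_clark_measure_def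
    by (intro poisson_integral_inject) auto
  ultimately show "\<exists>!\<sigma>. is_clark_measure \<phi> \<alpha> \<sigma>" by blast
qed

section \<open>Averaging the Clark measures over the circle\<close>

text \<open>Integrability in \<alpha> is asserted as well, because the Bochner integral of a
  nonintegrable function is zero by convention.\<close>

theorem proposition2p4:
  fixes \<phi> :: "complex ^ 'n \<Rightarrow> complex" and f :: "complex ^ 'n \<Rightarrow> complex"
  assumes "CARD('n) \<ge> 2"
    and "\<phi> holomorphic_several_on polydisc"
    and "\<phi> ` polydisc \<subseteq> ball 0 1"
    and "continuous_on torus f"
  shows "integrable circle_measure (\<lambda>\<alpha>. \<integral>\<zeta>. f \<zeta> \<partial>clark_measure \<phi> \<alpha>) \<and>
    (\<integral>\<alpha>. (\<integral>\<zeta>. f \<zeta> \<partial>clark_measure \<phi> \<alpha>) \<partial>circle_measure) = (\<integral>\<zeta>. f \<zeta> \<partial>torus_measure)"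
proof -
  note \<phi> = assms(2,3) and f = assms(4)
  have \<phi>_lt: "cmod (\<phi> z) < 1" if "z \<in> polydisc" for z
    using \<phi>(2) that by auto
  interpret C: prob_space circle_measure by (rule prob_space_circle_measure)
  interpret T: prob_space "torus_measure :: (complex ^ 'n) measure" by (rule prob_space_torus_measure)
  interpret CT: pair_sigma_finite circle_measure "torus_measure :: (complex ^ 'n) measure" ..
  interpret CTf: finite_measure "circle_measure \<Otimes>\<^sub>M (torus_measure :: (complex ^ 'n) measure)"
    by (intro finite_measure_pair_measure C.finite_measure_axioms T.finite_measure_axioms)
  note [measurable] = id_borel_restrict
  have f_meas [measurable]: "f \<in> borel_measurable (restrict_space borel torus)"
    using f by (rule borel_measurable_continuous_on_restrict)
  obtain B where B: "\<And>x. x \<in> torus \<Longrightarrow> cmod (f x) \<le> B" "0 \<le> B"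
    using compact_imp_bounded[OF compact_continuous_image[OF f compact_torus]]
    unfolding bounded_pos by (metis imageI less_imp_le)
  let ?\<phi> = "\<lambda>k \<eta>. \<phi> (radius k *\<^sub>R \<eta>)"
  have cont\<phi>: "continuous_on torus (?\<phi> k)" for k
    by (intro continuous_on_compose2[OF holomorphic_several_on_imp_continuous_on[OF \<phi>(1)]] continuous_intros)
      (auto simp: dilation_in_polydisc)
  then have \<phi>_meas [measurable]: "?\<phi> k \<in> borel_measurable (restrict_space borel torus)" for k
    by (rule borel_measurable_continuous_on_restrict)
  \<comment> \<open>For unimodular \<alpha> the second factor is the Poisson integral of the Clark
    measure at \<open>radius k *\<^sub>R \<eta>\<close>. In this form the dependence on \<alpha> is
    explicit and measurable.\<close>
  define I where "I k \<alpha> = (\<integral>\<eta>. f \<eta> * of_real (poisson_disc (?\<phi> k \<eta>) \<alpha>) \<partial>torus_measure)" for k \<alpha>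
  define J where "J \<alpha> = (\<integral>\<zeta>. f \<zeta> \<partial>clark_measure \<phi> \<alpha>)" for \<alpha>
  have I_lim: "(\<lambda>k. I k \<alpha>) \<longlonglongrightarrow> J \<alpha>" if \<alpha>: "\<alpha> \<in> space circle_measure" for \<alpha>
  proof -
    have a: "cmod \<alpha> = 1" using \<alpha> by simp
    note clark = is_clark_measure_clark_measure[OF \<phi> a, unfolded is_clark_measure_def]
    have "I k \<alpha> = (\<integral>\<eta>. f \<eta> * of_real (poisson_integral (clark_measure \<phi> \<alpha>) (radius k *\<^sub>R \<eta>)) \<partial>torus_measure)" for k
      unfolding I_def using clark
      by (intro Bochner_Integration.integral_cong refl) (simp add: dilation_in_polydisc Re_herglotz a)
    then show ?thesis
      unfolding J_def using integral_poisson_integral_limit[OF _ _ f] clark by simp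
  qed
  have I_meas: "I k \<in> borel_measurable circle_measure" for k
    unfolding I_def by measurable
  \<comment> \<open>The bound is uniform in \<open>k\<close> and \<alpha>: the mean of the dilated
    kernel over the torus is its value at the origin.\<close>
  have I_bound: "norm (I k \<alpha>) \<le> B * (1 / (1 - cmod (\<phi> 0))\<^sup>2)" if \<alpha>: "\<alpha> \<in> space circle_measure" for k \<alpha>
  proof -
    have a: "cmod \<alpha> = 1" using \<alpha> by simp
    have cont: "continuous_on torus (\<lambda>\<eta>. poisson_disc (?\<phi> k \<eta>) \<alpha>)"
      using cont\<phi> a by (intro continuous_intros) (auto simp: \<phi>_lt dilation_in_polydisc)
    have "norm (I k \<alpha>) \<le> (\<integral>\<eta>. B * poisson_disc (?\<phi> k \<eta>) \<alpha> \<partial>torus_measure)"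
      unfolding I_def
    proof (rule order_trans[OF integral_norm_bound], rule integral_mono)
      show "integrable torus_measure (\<lambda>\<eta>. cmod (f \<eta> * of_real (poisson_disc (?\<phi> k \<eta>) \<alpha>)))"
        "integrable torus_measure (\<lambda>\<eta>. B * poisson_disc (?\<phi> k \<eta>) \<alpha>)"
        using cont f by (auto intro!: integrable_torus_measure continuous_intros)
      fix \<eta> assume "\<eta> \<in> space (torus_measure :: (complex ^ 'n) measure)"
      then have "\<eta> \<in> torus" by simp
      then show "cmod (f \<eta> * of_real (poisson_disc (?\<phi> k \<eta>) \<alpha>)) \<le> B * poisson_disc (?\<phi> k \<eta>) \<alpha>"
        using B poisson_disc_nonneg[of "?\<phi> k \<eta>" \<alpha>] \<phi>_lt[OF dilation_in_polydisc, of \<eta> k]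
        by (simp add: norm_mult mult_right_mono)
    qed
    also have "\<dots> = B * poisson_disc (\<phi> 0) \<alpha>"
    proof -
      have "(\<lambda>z. \<phi> (radius k *\<^sub>R z)) ` closed_polydisc \<subseteq> ball 0 1"
        by (auto intro!: \<phi>_lt scaleR_closed_polydisc radius)
      from poisson_formula_herglotz[OF polydisc_algebra_dilation[OF \<phi>(1) radius] this zero_in_polydisc a]
      show ?thesis by simp
    qed
    also have "\<dots> \<le> B * (1 / (1 - cmod (\<phi> 0))\<^sup>2)"
      using B(2) a \<phi>_lt[OF zero_in_polydisc] by (intro mult_left_mono poisson_disc_le) auto
    finally show ?thesis .
  qed
  \<comment> \<open>After Fubini the inner integral in \<alpha> is the mass of the Poisson kernel of
    the disc at the point \<open>?\<phi> k \<eta>\<close>, which is one.\<close>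
  have I_int: "(\<integral>\<alpha>. I k \<alpha> \<partial>circle_measure) = (\<integral>\<eta>. f \<eta> \<partial>torus_measure)" for k
  proof -
    let ?K = "\<lambda>\<alpha> \<eta>. f \<eta> * of_real (poisson_disc (?\<phi> k \<eta>) \<alpha>)"
    \<comment> \<open>For fixed \<open>k\<close>, compactness keeps the dilated function away from
      the circle; this yields the bound \<open>D\<close> needed for Fubini.\<close>
    have "compact ((\<lambda>\<eta>. (1 / (1 - cmod (?\<phi> k \<eta>))\<^sup>2) :: real) ` torus)"
      using cont\<phi>[of k] \<phi>_lt[OF dilation_in_polydisc]
      by (intro compact_continuous_image compact_torus continuous_intros) (auto simp: less_le)
    then obtain D where "\<forall>y\<in>(\<lambda>\<eta>. 1 / (1 - cmod (?\<phi> k \<eta>))\<^sup>2) ` torus. norm y \<le> D"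
      using compact_imp_bounded bounded_iff by blast
    then have D: "1 / (1 - cmod (?\<phi> k \<eta>))\<^sup>2 \<le> D" if "\<eta> \<in> torus" for \<eta>
      using that by simp
    have int: "integrable (circle_measure \<Otimes>\<^sub>M torus_measure) (\<lambda>(\<alpha>, \<eta>). ?K \<alpha> \<eta>)"
    proof (rule CTf.integrable_const_bound[where B = "B * D"])
      show "(\<lambda>(\<alpha>, \<eta>). ?K \<alpha> \<eta>) \<in> borel_measurable (circle_measure \<Otimes>\<^sub>M torus_measure)"
        by measurable
      show "AE x in circle_measure \<Otimes>\<^sub>M torus_measure. norm (case x of (\<alpha>, \<eta>) \<Rightarrow> ?K \<alpha> \<eta>) \<le> B * D"
      proof (rule AE_I2, clarsimp simp: space_pair_measure norm_mult)
        fix \<alpha> :: complex and \<eta> :: "complex ^ 'n" assume a: "cmod \<alpha> = 1" and \<eta>: "\<eta> \<in> torus"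
        have lt: "cmod (?\<phi> k \<eta>) < 1"
          using \<phi>_lt[OF dilation_in_polydisc[OF \<eta>]] .
        have "\<bar>poisson_disc (?\<phi> k \<eta>) \<alpha>\<bar> \<le> D"
          using poisson_disc_nonneg[of "?\<phi> k \<eta>" \<alpha>] poisson_disc_le[of "?\<phi> k \<eta>" \<alpha>] lt a D[OF \<eta>] by simp
        then show "cmod (f \<eta>) * \<bar>poisson_disc (?\<phi> k \<eta>) \<alpha>\<bar> \<le> B * D"
          using B \<eta> by (intro mult_mono) auto
      qed
    qed
    have "(\<integral>\<alpha>. I k \<alpha> \<partial>circle_measure) = (\<integral>\<eta>. \<integral>\<alpha>. ?K \<alpha> \<eta> \<partial>circle_measure \<partial>torus_measure)"
      unfolding I_def by (rule CT.Fubini_integral[OF int, symmetric])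
    also have "\<dots> = (\<integral>\<eta>. f \<eta> \<partial>torus_measure)"
    proof (intro Bochner_Integration.integral_cong refl)
      fix \<eta> assume "\<eta> \<in> space (torus_measure :: (complex ^ 'n) measure)"
      then have "cmod (?\<phi> k \<eta>) < 1"
        using \<phi>_lt[OF dilation_in_polydisc] by simp
      then have "(\<integral>\<alpha>. complex_of_real (poisson_disc (?\<phi> k \<eta>) \<alpha>) * 1 \<partial>circle_measure) = 1"
        by (intro poisson_formula_disc) auto
      then show "(\<integral>\<alpha>. ?K \<alpha> \<eta> \<partial>circle_measure) = f \<eta>"
        by simp
    qed
    finally show ?thesis .
  qed
  \<comment> \<open>The definite description gives no measurability in \<alpha>; it comes from
    \<open>J\<close> being the pointwise limit of the \<open>I k\<close>.\<close>
  have J_meas: "J \<in> borel_measurable circle_measure"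
    using I_meas I_lim by (rule borel_measurable_LIMSEQ_metric)
  have "integrable circle_measure J"
    by (rule integrable_dominated_convergence[where s = I and w = "\<lambda>_. B * (1 / (1 - cmod (\<phi> 0))\<^sup>2)"])
      (use I_meas J_meas I_lim I_bound in auto)
  moreover have "(\<lambda>k. \<integral>\<alpha>. I k \<alpha> \<partial>circle_measure) \<longlonglongrightarrow> (\<integral>\<alpha>. J \<alpha> \<partial>circle_measure)"
    by (rule integral_dominated_convergence[where w = "\<lambda>_. B * (1 / (1 - cmod (\<phi> 0))\<^sup>2)"])
      (use I_meas J_meas I_lim I_bound in auto)
  ultimately show ?thesis
    unfolding I_int J_def by (simp add: LIMSEQ_const_iff)
qed

end
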